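(* Let $M$ and $N$ be substitution matrices whose associated Bratteli diagrams are telescope equivalent. Then $M$ is purely aperiodic if and only if $N$ is purely aperiodic.
   Context: A symbolic substitution on a finite nonempty alphabet $\mathcal L=\{l_1,\dots,l_n\}$ is a map $\sigma:\mathcal L\to\mathcal L^*$ into the finite words over $\mathcal L$. Its substitution matrix is the $n\times n$ non-negative integer matrix whose $(i,j)$-entry is the number of occurrences of $l_j$ in $\sigma(l_i)$. A non-negative square matrix is primitive if some power $M^k$, $k\in\mathbb N$, has all entries strictly positive. A primitive matrix has a real eigenvalue of multiplicity one whose modulus is greater than that of any other eigenvalue, called its PF-eigenvalue. A substitution matrix is purely aperiodic if it is primitive and its PF-eigenvalue is irrational. A (labelled) Bratteli diagram $(V,E,r,s,d)$ is an infinite directed graph with $V=\bigsqcup_{n\ge 0}V_n$, $E=\bigsqcup_{n\ge1}E_n$, all $V_n,E_n$ finite and nonempty, with $s(e)\in V_{n-1}$ and $r(e)\in V_n$ for $e\in E_n$; $s^{-1}(v)\ne\varnothing$ for all $v$, $r^{-1}(v)\neq\varnothing$ for all $v\notin V_0$; and a labelling $d:V\to\mathbb N$ with $d(v)=\sum_{r(e)=v}d(s(e))$ for $v\notin V_0$. The transition matrix from level $n-1$ to level $n$ has $(i,j)$-entry equal to the number of edges from the $i$-th vertex of $V_{n-1}$ to the $j$-th vertex of $V_n$. Two diagrams are isomorphic if there are bijections between their vertices and edges (level by level) preserving labels, range and source. Given a strictly increasing sequence $(m_n)_{n\ge0}$ of non-negative integers, the telescoping of the diagram has $V_n'=V_{m_n}$,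 $E_n'$ the set of paths from $V_{m_{n-1}}$ to $V_{m_n}$, with the induced range and source and restricted labelling; microscoping is the inverse operation. Two diagrams are telescope equivalent if one is obtained from the other by finitely many telescopings, microscopings and isomorphisms. The Bratteli diagram defined by (associated to) an $n\times n$ substitution matrix $M$ has $n$ vertices at every level, all labels equal to $1$ at level $0$, and every transition matrix equal to $M$ (it is understood that $M$ has no zero row or column, so that this is a Bratteli diagram). *)

theory Defs
  imports "Jordan_Normal_Form.Char_Poly" "HOL-Library.Countable_Set" "HOL-Library.Disjoint_Sets"
begin

text \<open>An alphabet is a nonempty list of distinct letters; the list fixes the order in which the
  letters index the rows and columns of the substitution matrix.\<close>

definition symbolic_substitution :: "'a list \<Rightarrow> ('a \<Rightarrow> 'a list) \<Rightarrow> bool" where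
  "symbolic_substitution L \<sigma> \<longleftrightarrow>
     L \<noteq> [] \<and> distinct L \<and> (\<forall>l \<in> set L. set (\<sigma> l) \<subseteq> set L)"

definition substitution_matrix :: "'a list \<Rightarrow> ('a \<Rightarrow> 'a list) \<Rightarrow> nat mat" where
  "substitution_matrix L \<sigma> =
     mat (length L) (length L) (\<lambda>(i, j). count_list (\<sigma> (L ! i)) (L ! j))"

definition no_zero_row_or_col :: "nat mat \<Rightarrow> bool" where
  "no_zero_row_or_col M \<longleftrightarrow>
     (\<forall>i < dim_row M. \<exists>j < dim_col M. M $$ (i, j) \<noteq> 0) \<and>
     (\<forall>j < dim_col M. \<exists>i < dim_row M. M $$ (i, j) \<noteq> 0)"

definition primitive_mat :: "nat mat \<Rightarrow> bool" where
  "primitive_mat M \<longleftrightarrow> square_mat M \<and>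
     (\<exists>k \<ge> 1. \<forall>i < dim_row M. \<forall>j < dim_col M. (M ^\<^sub>m k) $$ (i, j) > 0)"

text \<open>Eigenvalues range over the complex numbers and multiplicity is algebraic.\<close>

definition is_PF_eigenvalue :: "nat mat \<Rightarrow> real \<Rightarrow> bool" where
  "is_PF_eigenvalue M \<theta> \<longleftrightarrow>
     (let A = map_mat of_nat M :: complex mat in
       eigenvalue A (complex_of_real \<theta>) \<and>
       Polynomial.order (complex_of_real \<theta>) (char_poly A) = 1 \<and>
       (\<forall>\<mu>. eigenvalue A \<mu> \<and> \<mu> \<noteq> complex_of_real \<theta> \<longrightarrow> cmod \<mu> < \<bar>\<theta>\<bar>))"

lemma is_PF_eigenvalue_unique:
  assumes "is_PF_eigenvalue M \<theta>" and "is_PF_eigenvalue M \<mu>"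
  shows "\<theta> = \<mu>"
proof (rule ccontr)
  assume "\<theta> \<noteq> \<mu>"
  then have ne: "complex_of_real \<theta> \<noteq> complex_of_real \<mu>"
    by simp
  have "cmod (complex_of_real \<mu>) < \<bar>\<theta>\<bar>"
    using assms ne unfolding is_PF_eigenvalue_def Let_def by metis
  moreover have "cmod (complex_of_real \<theta>) < \<bar>\<mu>\<bar>"
    using assms ne unfolding is_PF_eigenvalue_def Let_def by metis
  ultimately show False
    by simp
qed

definition purely_aperiodic :: "nat mat \<Rightarrow> bool" where
  "purely_aperiodic M \<longleftrightarrow> primitive_mat M \<and> (\<exists>\<theta>. is_PF_eigenvalue M \<theta> \<and> \<theta> \<notin> \<rat>)"


record ('v, 'e) bratteli =
  bverts :: "nat \<Rightarrow> 'v set"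
  bedges :: "nat \<Rightarrow> 'e set"
  bsrc   :: "'e \<Rightarrow> 'v"
  brng   :: "'e \<Rightarrow> 'v"
  blab   :: "'v \<Rightarrow> nat"

text \<open>Edge sets are indexed from 1, the edges of index \<open>Suc n\<close> leading from level \<open>n\<close> to level
  \<open>Suc n\<close>; the unused index 0 carries the empty set. The label 0 is not excluded. Forbidding it
  would only shrink the relation \<open>telescope_equivalent\<close> defined below.\<close>

definition bratteli_diagram :: "('v, 'e) bratteli \<Rightarrow> bool" where
  "bratteli_diagram D \<longleftrightarrow>
     disjoint_family (bverts D) \<and> disjoint_family (bedges D) \<and>
     (\<forall>n. finite (bverts D n) \<and> bverts D n \<noteq> {}) \<and>
     bedges D 0 = {} \<and>
     (\<forall>n. finite (bedges D (Suc n)) \<and> bedges D (Suc n) \<noteq> {}) \<and>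
     (\<forall>n. \<forall>e \<in> bedges D (Suc n). bsrc D e \<in> bverts D n \<and> brng D e \<in> bverts D (Suc n)) \<and>
     (\<forall>n. \<forall>v \<in> bverts D n. \<exists>e \<in> bedges D (Suc n). bsrc D e = v) \<and>
     (\<forall>n. \<forall>v \<in> bverts D (Suc n). \<exists>e \<in> bedges D (Suc n). brng D e = v) \<and>
     (\<forall>n. \<forall>v \<in> bverts D (Suc n).
        blab D v = (\<Sum>e \<in> {e \<in> bedges D (Suc n). brng D e = v}. blab D (bsrc D e)))"

definition bratteli_iso :: "('v, 'e) bratteli \<Rightarrow> ('w, 'f) bratteli \<Rightarrow> bool" where
  "bratteli_iso D D' \<longleftrightarrow>
     (\<exists>f g. (\<forall>n. bij_betw f (bverts D n) (bverts D' n)) \<and>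
            (\<forall>n. bij_betw g (bedges D n) (bedges D' n)) \<and>
            (\<forall>n. \<forall>v \<in> bverts D n. blab D' (f v) = blab D v) \<and>
            (\<forall>n. \<forall>e \<in> bedges D n.
               bsrc D' (g e) = f (bsrc D e) \<and> brng D' (g e) = f (brng D e)))"

definition bratteli_paths :: "('v, 'e) bratteli \<Rightarrow> nat \<Rightarrow> nat \<Rightarrow> 'e list set" where
  "bratteli_paths D a b =
     {es. length es = b - a \<and>
          (\<forall>i < length es. es ! i \<in> bedges D (Suc (a + i))) \<and>
          (\<forall>i. Suc i < length es \<longrightarrow> brng D (es ! i) = bsrc D (es ! Suc i))}"

definition telescoping :: "(nat \<Rightarrow> nat) \<Rightarrow> ('v, 'e) bratteli \<Rightarrow> ('v, 'e list) bratteli" where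
  "telescoping m D =
     \<lparr> bverts = (\<lambda>n. bverts D (m n)),
       bedges = (\<lambda>n. if n = 0 then {} else bratteli_paths D (m (n - 1)) (m n)),
       bsrc = (\<lambda>es. bsrc D (hd es)),
       brng = (\<lambda>es. brng D (last es)),
       blab = blab D \<rparr>"

text \<open>One step of the equivalence: an isomorphism, a telescoping, or a microscoping (the converse
  of a telescoping). Telescoping changes the type of edges, whereas a chain of steps needs a single
  type. The steps therefore relate diagrams whose vertices and edges are natural numbers, and a
  telescoping is taken up to isomorphism. Nothing is lost, since every Bratteli diagram has
  countably many vertices and edges (lemma \<open>bratteli_iso_nat\<close>).\<close>

definition telescope_step :: "(nat, nat) bratteli \<Rightarrow> (nat, nat) bratteli \<Rightarrow> bool" where
  "telescope_step D D' \<longleftrightarrow>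
     bratteli_diagram D \<and> bratteli_diagram D' \<and>
     (bratteli_iso D D' \<or>
      (\<exists>m. strict_mono m \<and> bratteli_iso (telescoping m D) D') \<or>
      (\<exists>m. strict_mono m \<and> bratteli_iso (telescoping m D') D))"

definition telescope_equivalent :: "('v, 'e) bratteli \<Rightarrow> ('w, 'f) bratteli \<Rightarrow> bool" where
  "telescope_equivalent D D' \<longleftrightarrow>
     (\<exists>C C'. bratteli_diagram C \<and> bratteli_diagram C' \<and>
             bratteli_iso D C \<and> telescope_step\<^sup>*\<^sup>* C C' \<and> bratteli_iso C' D')"

lemma bratteli_iso_nat:
  fixes D :: "('v, 'e) bratteli"
  assumes D: "bratteli_diagram D"
  obtains C :: "(nat, nat) bratteli" where "bratteli_diagram C" "bratteli_iso D C"
proof -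
  define VV where "VV = (\<Union>n. bverts D n)"
  define EE where "EE = (\<Union>n. bedges D n)"
  note D' = D[unfolded bratteli_diagram_def]
  have finE: "finite (bedges D n)" for n
    using D' by (cases n) auto
  have "countable VV" "countable EE"
    unfolding VV_def EE_def using D' finE by (simp_all add: countable_finite)
  then obtain f g :: "_ \<Rightarrow> nat" where f: "inj_on f VV" and g: "inj_on g EE"
    unfolding countable_def by blast
  have subV: "bverts D n \<subseteq> VV" and subE: "bedges D n \<subseteq> EE" for n
    unfolding VV_def EE_def by auto
  define f' where "f' = inv_into VV f"
  define g' where "g' = inv_into EE g"
  have f'f: "f' (f v) = v" if "v \<in> bverts D n" for v n
    using that subV[of n] f unfolding f'_def by (auto simp: inv_into_f_f)
  have g'g: "g' (g e) = e" if "e \<in> bedges D n" for e n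
    using that subE[of n] g unfolding g'_def by (auto simp: inv_into_f_f)
  define C where "C = \<lparr> bverts = (\<lambda>n. f ` bverts D n), bedges = (\<lambda>n. g ` bedges D n),
     bsrc = (\<lambda>e. f (bsrc D (g' e))), brng = (\<lambda>e. f (brng D (g' e))),
     blab = (\<lambda>v. blab D (f' v)) \<rparr>"
  have inC: "bverts C n = f ` bverts D n" "bedges C n = g ` bedges D n"
     "bsrc C e = f (bsrc D (g' e))" "brng C e = f (brng D (g' e))" "blab C v = blab D (f' v)" for n e v
    by (simp_all add: C_def)
  have iso: "bratteli_iso D C"
    unfolding bratteli_iso_def
    by (intro exI[of _ f] exI[of _ g])
      (auto simp: inC f'f g'g bij_betw_def intro: inj_on_subset[OF f subV] inj_on_subset[OF g subE])
  have disj: "disjoint_family (\<lambda>n. h ` X n)"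
    if "disjoint_family X" "inj_on h (\<Union>n. X n)" for X :: "nat \<Rightarrow> 'x set" and h :: "'x \<Rightarrow> nat"
    using that unfolding disjoint_family_on_def inj_on_def by blast
  have src: "bsrc D e \<in> bverts D n" and rng: "brng D e \<in> bverts D (Suc n)"
    if "e \<in> bedges D (Suc n)" for e n
    using D' that by auto
  have eq: "f v = f w \<longleftrightarrow> v = w" if "v \<in> bverts D n" "w \<in> bverts D n" for v w n
    using f'f that by metis
  have lab: "blab C (f v) =
      (\<Sum>e \<in> {e \<in> bedges C (Suc n). brng C e = f v}. blab C (bsrc C e))"
    if v: "v \<in> bverts D (Suc n)" for v n
  proof -
    have set: "{e \<in> bedges C (Suc n). brng C e = f v} =
        g ` {e \<in> bedges D (Suc n). brng D e = v}" (is "_ = g ` ?S")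
      by (auto simp: inC g'g eq[OF rng v])
    have "inj_on g ?S"
      by (rule inj_on_subset[OF g]) (use subE[of "Suc n"] in auto)
    then have "(\<Sum>e \<in> g ` ?S. blab C (bsrc C e)) = (\<Sum>e \<in> ?S. blab C (bsrc C (g e)))"
      by (simp add: sum.reindex)
    also have "\<dots> = (\<Sum>e \<in> ?S. blab D (bsrc D e))"
      by (rule sum.cong) (auto simp: inC g'g f'f[OF src])
    also have "\<dots> = blab C (f v)"
      using D' v by (auto simp: inC f'f)
    finally show ?thesis
      by (simp add: set)
  qed
  have outC: "\<exists>e \<in> bedges C (Suc n). bsrc C e = f v" if v: "v \<in> bverts D n" for v n
  proof -
    obtain e where "e \<in> bedges D (Suc n)" "bsrc D e = v"
      using D' v by meson
    then show ?thesis
      by (auto simp: inC g'g intro!: bexI[of _ e])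
  qed
  have inC': "\<exists>e \<in> bedges C (Suc n). brng C e = f v" if v: "v \<in> bverts D (Suc n)" for v n
  proof -
    obtain e where "e \<in> bedges D (Suc n)" "brng D e = v"
      using D' v by meson
    then show ?thesis
      by (auto simp: inC g'g intro!: bexI[of _ e])
  qed
  have V: "disjoint_family (bverts C)" and E: "disjoint_family (bedges C)"
    using disj[of "bverts D" f] disj[of "bedges D" g] D' f g
    by (simp_all add: C_def VV_def EE_def)
  have fin: "finite (bverts C n) \<and> bverts C n \<noteq> {}"
    "finite (bedges C (Suc n)) \<and> bedges C (Suc n) \<noteq> {}" "bedges C 0 = {}" for n
    using D' by (auto simp: inC)
  have ends: "bsrc C e \<in> bverts C n \<and> brng C e \<in> bverts C (Suc n)"
    if "e \<in> bedges C (Suc n)" for e n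
    using that src rng by (auto simp: inC g'g)
  have "bratteli_diagram C"
    unfolding bratteli_diagram_def
    using V E fin ends outC inC' lab by (simp add: inC(1))
  then show ?thesis
    using iso that by blast
qed

text \<open>Vertex \<open>(n, i)\<close> is the \<open>i\<close>-th vertex of level \<open>n\<close>; for \<open>k < M $$ (i, j)\<close>, the edge
  \<open>(n, i, j, k)\<close> is the \<open>k\<close>-th edge from \<open>(n - 1, i)\<close> to \<open>(n, j)\<close>.\<close>

fun matrix_label :: "nat mat \<Rightarrow> nat \<Rightarrow> nat \<Rightarrow> nat" where
  "matrix_label M 0 j = 1"
| "matrix_label M (Suc n) j = (\<Sum>i < dim_row M. M $$ (i, j) * matrix_label M n i)"

definition matrix_bratteli ::
    "nat mat \<Rightarrow> (nat \<times> nat, nat \<times> nat \<times> nat \<times> nat) bratteli" where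
  "matrix_bratteli M =
     \<lparr> bverts = (\<lambda>n. {(n, i) | i. i < dim_row M}),
       bedges = (\<lambda>n. if n = 0 then {} else
         {(n, i, j, k) | i j k. i < dim_row M \<and> j < dim_row M \<and> k < M $$ (i, j)}),
       bsrc = (\<lambda>(n, i, j, k). (n - 1, i)),
       brng = (\<lambda>(n, i, j, k). (n, j)),
       blab = (\<lambda>(n, i). matrix_label M n i) \<rparr>"

lemma bratteli_diagram_matrix_bratteli:
  assumes sq: "square_mat M" and pos: "0 < dim_row M" and nz: "no_zero_row_or_col M"
  shows "bratteli_diagram (matrix_bratteli M)"
proof -
  let ?d = "dim_row M"
  let ?D = "matrix_bratteli M"
  have V: "bverts ?D n = Pair n ` {..<?d}" for n
    by (auto simp: matrix_bratteli_def)
  have E: "bedges ?D (Suc n) =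
      (\<lambda>(i, j, k). (Suc n, i, j, k)) ` (SIGMA i:{..<?d}. SIGMA j:{..<?d}. {..<M $$ (i, j)})" for n
    by (auto simp: matrix_bratteli_def image_iff)
  have E0: "bedges ?D 0 = {}"
    by (simp add: matrix_bratteli_def)
  have s: "bsrc ?D (n, i, j, k) = (n - 1, i)" and r: "brng ?D (n, i, j, k) = (n, j)"
    and l: "blab ?D (n, i) = matrix_label M n i" for n i j k
    by (simp_all add: matrix_bratteli_def)
  have row: "\<exists>j < ?d. 0 < M $$ (i, j)" and col: "\<exists>j < ?d. 0 < M $$ (j, i)" if "i < ?d" for i
    using nz sq that by (auto simp: no_zero_row_or_col_def)
  have out: "\<exists>e \<in> bedges ?D (Suc n). bsrc ?D e = (n, i)" if i: "i < ?d" for n i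
  proof -
    obtain j where "j < ?d" "0 < M $$ (i, j)" using row[OF i] by blast
    then show ?thesis
      using i by (intro bexI[of _ "(Suc n, i, j, 0)"]) (auto simp: s E image_iff)
  qed
  have inn: "\<exists>e \<in> bedges ?D (Suc n). brng ?D e = (Suc n, i)" if i: "i < ?d" for n i
  proof -
    obtain j where "j < ?d" "0 < M $$ (j, i)" using col[OF i] by blast
    then show ?thesis
      using i by (intro bexI[of _ "(Suc n, j, i, 0)"]) (auto simp: r E image_iff)
  qed
  have lab: "blab ?D (Suc n, j) =
      (\<Sum>e \<in> {e \<in> bedges ?D (Suc n). brng ?D e = (Suc n, j)}. blab ?D (bsrc ?D e))"
    if j: "j < ?d" for n j
  proof -
    have S: "{e \<in> bedges ?D (Suc n). brng ?D e = (Suc n, j)} =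
        (\<lambda>(i, k). (Suc n, i, j, k)) ` (SIGMA i:{..<?d}. {..<M $$ (i, j)})"
      using j by (auto simp: E r image_iff)
    have inj: "inj_on (\<lambda>(i, k). (Suc n, i, j, k)) (SIGMA i:{..<?d}. {..<M $$ (i, j)})"
      by (auto simp: inj_on_def)
    have "(\<Sum>e \<in> {e \<in> bedges ?D (Suc n). brng ?D e = (Suc n, j)}. blab ?D (bsrc ?D e)) =
        (\<Sum>(i, k) \<in> (SIGMA i:{..<?d}. {..<M $$ (i, j)}). matrix_label M n i)"
      unfolding S sum.reindex[OF inj] by (rule sum.cong) (auto simp: s l)
    also have "\<dots> = (\<Sum>i < ?d. \<Sum>k < M $$ (i, j). matrix_label M n i)"
      by (subst sum.Sigma) auto
    finally show ?thesis
      by (simp add: l)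
  qed
  have Ene: "bedges ?D (Suc n) \<noteq> {}" for n
    using out[OF pos, of n] by blast
  have dV: "disjoint_family (bverts ?D)"
    by (auto simp: disjoint_family_on_def V)
  have dE: "disjoint_family (bedges ?D)"
    by (auto simp: disjoint_family_on_def matrix_bratteli_def)
  have fV: "finite (bverts ?D n) \<and> bverts ?D n \<noteq> {}" for n
    using pos by (auto simp: V)
  have fE: "finite (bedges ?D (Suc n))" for n
    by (auto simp: E)
  have ends: "bsrc ?D e \<in> bverts ?D n \<and> brng ?D e \<in> bverts ?D (Suc n)"
    if "e \<in> bedges ?D (Suc n)" for e n
    using that by (auto simp: E V s r)
  show ?thesis
    unfolding bratteli_diagram_def
    using dV dE fV fE E0 Ene ends out inn lab by (simp add: V)
qed

end

theory Submission
  imports Defs "Jordan_Normal_Form.Spectral_Radius"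
begin

text \<open>
  Two properties of a Bratteli diagram, both insensitive to telescoping, detect whether the
  substitution matrix behind a stationary diagram is purely aperiodic.

  The first is simplicity: every level is followed by a level all of whose vertices can be reached
  from all of its vertices. For the diagram of \<open>M\<close> the number of paths between two levels is an
  entry of a power of \<open>M\<close>, so simplicity says that \<open>M\<close> is primitive (\<open>primitive_iff_simple\<close>).

  The second is the existence of a strictly positive rational trace, that is, of a function \<open>x\<close> on
  the vertices whose value at a vertex is the sum of its values at the ranges of the edges starting
  there. Such a function extends along a microscoping by summation over paths and restricts to a
  telescoping (\<open>trace_telescoping\<close>). On the diagram of a primitive matrix \<open>M\<close> with PF-eigenvalue
  \<open>\<theta>\<close> and positive right eigenvector \<open>v\<close>, the values of a positive trace on level 0 are
  proportional to \<open>v\<close> (\<open>trace_unique\<close>). If they are rational, then so is \<open>\<theta>\<close>, the factor by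
  which \<open>M\<close> multiplies them. Conversely, a rational \<open>\<theta>\<close> has an eigenvector with rational entries;
  it is a multiple of \<open>v\<close> (\<open>perron_eigenspace\<close>), and \<open>v i / \<theta> ^ s\<close> at the vertex \<open>(s, i)\<close> becomes
  rational after rescaling (\<open>trace_iff_rational\<close>).

  What remains is the Perron-Frobenius theorem for primitive matrices. A positive eigenvector is
  the vector of absolute values of an eigenvector for an eigenvalue of maximal modulus
  (\<open>perron_vector\<close>). Dominance and simplicity of \<open>\<theta>\<close> and uniqueness of the trace all follow from
  one estimate: on the hyperplane orthogonal to the positive left eigenvector \<open>w\<close>, some power
  \<open>M ^ k\<close> multiplies a weighted 1-norm by at most \<open>\<rho> \<theta> ^ k\<close> with \<open>\<rho> < 1\<close> (\<open>contraction\<close>), so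
  that a backward orbit in this hyperplane bounded by a multiple of \<open>\<theta> ^ (- s)\<close> is zero
  (\<open>backward_orbit_zero\<close>).
\<close>

section \<open>Counting paths\<close>

definition edge_count :: "('v, 'e) bratteli \<Rightarrow> nat \<Rightarrow> 'v \<Rightarrow> 'v \<Rightarrow> nat" where
  "edge_count D n v w = card {e \<in> bedges D (Suc n). bsrc D e = v \<and> brng D e = w}"

fun path_count :: "('v, 'e) bratteli \<Rightarrow> nat \<Rightarrow> nat \<Rightarrow> 'v \<Rightarrow> 'v \<Rightarrow> nat" where
  "path_count D a 0 v w = of_bool (v = w)"
| "path_count D a (Suc k) v w =
     (\<Sum>u \<in> bverts D (Suc a). edge_count D a v u * path_count D (Suc a) k u w)"

lemma diagram_finite:
  assumes "bratteli_diagram D"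
  shows "finite (bverts D n)" "bverts D n \<noteq> {}" "finite (bedges D n)"
  using assms unfolding bratteli_diagram_def by (auto, cases n, auto)

lemma diagram_ends:
  assumes "bratteli_diagram D" "e \<in> bedges D (Suc n)"
  shows "bsrc D e \<in> bverts D n" "brng D e \<in> bverts D (Suc n)"
  using assms unfolding bratteli_diagram_def by auto

lemma diagram_level_unique:
  assumes "bratteli_diagram D" "v \<in> bverts D a" "v \<in> bverts D b"
  shows "a = b"
  using assms unfolding bratteli_diagram_def disjoint_family_on_def by blast

text \<open>Cut each path at the intermediate level.\<close>

lemma path_count_add:
  assumes D: "bratteli_diagram D" and v: "v \<in> bverts D a"
  shows "path_count D a (k + l) v w =
    (\<Sum>u \<in> bverts D (a + k). path_count D a k v u * path_count D (a + k) l u w)"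
  using v
proof (induction k arbitrary: a v)
  case 0
  show ?case
    using 0 diagram_finite[OF D] by (simp add: sum.delta)
next
  case (Suc k)
  have "path_count D a (Suc k + l) v w =
      (\<Sum>u \<in> bverts D (Suc a). edge_count D a v u *
        (\<Sum>t \<in> bverts D (Suc a + k). path_count D (Suc a) k u t * path_count D (Suc a + k) l t w))"
    using Suc.IH by simp
  also have "\<dots> = (\<Sum>t \<in> bverts D (a + Suc k). \<Sum>u \<in> bverts D (Suc a).
        edge_count D a v u * path_count D (Suc a) k u t * path_count D (a + Suc k) l t w)"
    unfolding sum_distrib_left by (subst sum.swap) (simp add: mult.assoc)
  also have "\<dots> = (\<Sum>t \<in> bverts D (a + Suc k).
        path_count D a (Suc k) v t * path_count D (a + Suc k) l t w)"
    by (simp add: sum_distrib_right)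
  finally show ?case .
qed

section \<open>Path counts under telescoping and isomorphism\<close>

definition paths_between :: "('v, 'e) bratteli \<Rightarrow> nat \<Rightarrow> nat \<Rightarrow> 'v \<Rightarrow> 'v \<Rightarrow> 'e list set" where
  "paths_between D a b v w =
     {es \<in> bratteli_paths D a b. bsrc D (hd es) = v \<and> brng D (last es) = w}"

text \<open>The tail has positive length here; a path of length 0 is the empty list and has lost its
  vertex, so that \<open>hd\<close> would be meaningless.\<close>

lemma bratteli_paths_Cons:
  "e # es \<in> bratteli_paths D a (Suc (Suc a + k)) \<longleftrightarrow>
     e \<in> bedges D (Suc a) \<and> es \<in> bratteli_paths D (Suc a) (Suc (Suc a + k)) \<and>
     brng D e = bsrc D (hd es)"
  (is "?l \<longleftrightarrow> ?r")
proof
  assume l: ?l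
  then have len: "length es = Suc k"
    by (simp add: bratteli_paths_def)
  have edge: "(e # es) ! i \<in> bedges D (Suc (a + i))" if "i \<le> Suc k" for i
    using l that len unfolding bratteli_paths_def by auto
  have link: "brng D ((e # es) ! i) = bsrc D ((e # es) ! Suc i)" if "i \<le> k" for i
    using l that len unfolding bratteli_paths_def by auto
  show ?r
    using edge[of 0] link[of 0] edge[of "Suc i" for i] link[of "Suc i" for i] len
    unfolding bratteli_paths_def by (cases es) auto
next
  assume r: ?r
  then have len: "length es = Suc k"
    by (auto simp add: bratteli_paths_def)
  then have "hd es = es ! 0"
    by (metis hd_conv_nth list.size(3) nat.simps(3))
  then show ?l
    using r len unfolding bratteli_paths_def
    by (auto simp: nth_Cons split: nat.splits)
qed

text \<open>Paths are sorted by the range of their first edge, which mirrors the recursion of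
  \<open>path_count\<close>.\<close>

lemma card_paths_between:
  assumes D: "bratteli_diagram D" and v: "v \<in> bverts D a"
  shows "finite (paths_between D a (Suc a + k) v w) \<and>
    card (paths_between D a (Suc a + k) v w) = path_count D a (Suc k) v w"
  using v
proof (induction k arbitrary: a v)
  case 0
  have "paths_between D a (Suc a + 0) v w =
      (\<lambda>e. [e]) ` {e \<in> bedges D (Suc a). bsrc D e = v \<and> brng D e = w}"
    by (auto simp: paths_between_def bratteli_paths_def length_Suc_conv)
  moreover have "edge_count D a v w = 0" if "w \<notin> bverts D (Suc a)"
  proof -
    have "{e \<in> bedges D (Suc a). bsrc D e = v \<and> brng D e = w} = {}"
      using that diagram_ends(2)[OF D] by auto
    then show ?thesis
      unfolding edge_count_def by (simp only: card.empty)
  qed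
  moreover have "path_count D a (Suc 0) v w =
      (\<Sum>u \<in> bverts D (Suc a). if u = w then edge_count D a v w else 0)"
    by (auto intro!: sum.cong)
  ultimately show ?case
    using diagram_finite[OF D]
    by (auto simp: card_image inj_on_def edge_count_def sum.delta)
next
  case (Suc k)
  define S where "S u = (\<lambda>(e, es). e # es) `
    ({e \<in> bedges D (Suc a). bsrc D e = v \<and> brng D e = u} \<times> paths_between D (Suc a) (Suc (Suc a) + k) u w)"
    for u
  have eq: "paths_between D a (Suc a + Suc k) v w = (\<Union>u \<in> bverts D (Suc a). S u)"
    (is "?P = ?U")
  proof
    show "?P \<subseteq> ?U"
    proof
      fix p assume p: "p \<in> ?P"
      then obtain e es where ees: "p = e # es"
        by (cases p) (auto simp: paths_between_def bratteli_paths_def)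
      have *: "e \<in> bedges D (Suc a)" "es \<in> bratteli_paths D (Suc a) (Suc (Suc a + k))"
        "brng D e = bsrc D (hd es)" "bsrc D e = v" "brng D (last (e # es)) = w"
        using p bratteli_paths_Cons[of e es D a k] unfolding ees paths_between_def by auto
      then have "es \<noteq> []"
        by (auto simp: bratteli_paths_def)
      with * have "p \<in> S (brng D e)"
        unfolding S_def ees paths_between_def by auto
      then show "p \<in> ?U"
        using diagram_ends(2)[OF D *(1)] by blast
    qed
    show "?U \<subseteq> ?P"
    proof
      fix p assume "p \<in> ?U"
      then obtain e es where *: "p = e # es" "e \<in> bedges D (Suc a)" "bsrc D e = v"
        "es \<in> paths_between D (Suc a) (Suc (Suc a) + k) (brng D e) w"
        unfolding S_def by auto
      then have "es \<noteq> []"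
        by (auto simp: paths_between_def bratteli_paths_def)
      then show "p \<in> ?P"
        using * bratteli_paths_Cons[of e es D a k] unfolding paths_between_def by auto
    qed
  qed
  have fin: "finite (S u)" and
    card: "card (S u) = edge_count D a v u * path_count D (Suc a) (Suc k) u w"
    if "u \<in> bverts D (Suc a)" for u
    using Suc.IH[OF that] diagram_finite[OF D]
    by (auto simp: S_def card_image inj_on_def card_cartesian_product edge_count_def)
  have "card ?U = (\<Sum>u \<in> bverts D (Suc a). card (S u))"
    by (rule card_UN_disjoint) (use fin diagram_finite[OF D] in \<open>auto simp: S_def\<close>)
  then show ?case
    unfolding eq using fin card diagram_finite[OF D] by simp
qed

lemma edge_count_telescoping:
  assumes D: "bratteli_diagram D" and m: "strict_mono m" and v: "v \<in> bverts D (m n)"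
  shows "edge_count (telescoping m D) n v w = path_count D (m n) (m (Suc n) - m n) v w"
proof -
  obtain k where k: "m (Suc n) = Suc (m n) + k"
    using m by (metis less_iff_Suc_add strict_mono_Suc_iff add_Suc)
  have "edge_count (telescoping m D) n v w = card (paths_between D (m n) (m (Suc n)) v w)"
    by (simp add: edge_count_def telescoping_def paths_between_def)
  then show ?thesis
    using card_paths_between[OF D v, of k w] by (simp add: k)
qed

lemma path_count_telescoping:
  assumes D: "bratteli_diagram D" and m: "strict_mono m" and v: "v \<in> bverts D (m n)"
  shows "path_count (telescoping m D) n k v w = path_count D (m n) (m (n + k) - m n) v w"
  using v
proof (induction k arbitrary: n v)
  case (Suc k)
  have le: "m n \<le> m (Suc n)" "m (Suc n) \<le> m (n + Suc k)"
    using m by (simp_all add: strict_mono_less_eq)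
  have "path_count (telescoping m D) n (Suc k) v w =
      (\<Sum>u \<in> bverts D (m (Suc n)). path_count D (m n) (m (Suc n) - m n) v u *
         path_count D (m (Suc n)) (m (n + Suc k) - m (Suc n)) u w)"
    using Suc by (simp add: edge_count_telescoping[OF D m])
      (simp add: telescoping_def Suc.IH)
  also have "\<dots> = path_count D (m n) ((m (Suc n) - m n) + (m (n + Suc k) - m (Suc n))) v w"
    by (subst path_count_add[OF D Suc.prems]) (simp add: le)
  finally show ?case
    using le by simp
qed simp


text \<open>The edges matter only through their number, so isomorphisms are weakened to vertex bijections
  that preserve the transition matrices. This relation is symmetric without asking that the edge
  sets of different levels be disjoint, a condition that would have to be verified for the path sets
  of a telescoping.\<close>

definition same_transitions ::
    "('v \<Rightarrow> 'w) \<Rightarrow> ('v, 'e) bratteli \<Rightarrow> ('w, 'f) bratteli \<Rightarrow> bool" where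
  "same_transitions f D D' \<longleftrightarrow>
     (\<forall>n. bij_betw f (bverts D n) (bverts D' n)) \<and>
     (\<forall>n. \<forall>v \<in> bverts D n. \<forall>w \<in> bverts D (Suc n).
        edge_count D' n (f v) (f w) = edge_count D n v w)"

lemma same_transitions_iso:
  assumes iso: "bratteli_iso D D'"
    and ends: "\<And>n e. e \<in> bedges D (Suc n) \<Longrightarrow>
      bsrc D e \<in> bverts D n \<and> brng D e \<in> bverts D (Suc n)"
  obtains f where "same_transitions f D D'"
proof -
  obtain f g where f: "\<And>n. bij_betw f (bverts D n) (bverts D' n)"
    and g: "\<And>n. bij_betw g (bedges D n) (bedges D' n)"
    and fg: "\<And>n e. e \<in> bedges D n \<Longrightarrow> bsrc D' (g e) = f (bsrc D e) \<and> brng D' (g e) = f (brng D e)"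
    using iso unfolding bratteli_iso_def by metis
  have "edge_count D' n (f v) (f w) = edge_count D n v w"
    if v: "v \<in> bverts D n" and w: "w \<in> bverts D (Suc n)" for n v w
  proof -
    have "{e \<in> bedges D' (Suc n). bsrc D' e = f v \<and> brng D' e = f w} =
        g ` {e \<in> bedges D (Suc n). bsrc D e = v \<and> brng D e = w}"
      (is "?S' = g ` ?S")
    proof
      show "g ` ?S \<subseteq> ?S'"
        using bij_betwE[OF g] fg by auto
      show "?S' \<subseteq> g ` ?S"
      proof
        fix e' assume e': "e' \<in> ?S'"
        then obtain e where e: "e \<in> bedges D (Suc n)" "e' = g e"
          using bij_betw_imp_surj_on[OF g[of "Suc n"]] by blast
        then have "f (bsrc D e) = f v" "f (brng D e) = f w"
          using e' fg by auto
        then have "bsrc D e = v" "brng D e = w"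
          using ends[OF e(1)] v w bij_betw_imp_inj_on[OF f] by (auto dest: inj_onD)
        then show "e' \<in> g ` ?S"
          using e by auto
      qed
    qed
    moreover have "inj_on g {e \<in> bedges D (Suc n). bsrc D e = v \<and> brng D e = w}"
      by (rule inj_on_subset[OF bij_betw_imp_inj_on[OF g[of "Suc n"]]]) auto
    ultimately show ?thesis
      by (simp add: edge_count_def card_image)
  qed
  then have "same_transitions f D D'"
    using f by (simp add: same_transitions_def)
  then show ?thesis ..
qed


lemma same_transitions_sym:
  assumes f: "same_transitions f D D'" and disj: "disjoint_family (bverts D')"
  obtains g where "same_transitions g D' D"
proof -
  let ?g = "inv_into (\<Union>n. bverts D n) f"
  have bij: "bij_betw f (bverts D n) (bverts D' n)" for n
    using f by (simp add: same_transitions_def)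
  have onto: "f ` bverts D n = bverts D' n" for n
    by (rule bij_betw_imp_surj_on[OF bij])
  have inj: "inj_on f (\<Union>n. bverts D n)"
  proof (rule inj_onI)
    fix v w assume vw: "v \<in> (\<Union>n. bverts D n)" "w \<in> (\<Union>n. bverts D n)" "f v = f w"
    then obtain a b where ab: "v \<in> bverts D a" "w \<in> bverts D b"
      by blast
    with vw onto disj have "a = b"
      unfolding disjoint_family_on_def by blast
    with ab vw show "v = w"
      using bij_betw_imp_inj_on[OF bij] by (auto dest: inj_onD)
  qed
  have gf: "?g (f v) = v" if "v \<in> bverts D n" for v n
    using inj that by (auto intro: inv_into_f_f)
  have "bij_betw ?g (bverts D' n) (bverts D n)" for n
    by (rule bij_betw_byWitness[where f' = f]) (use gf in \<open>auto simp: onto[symmetric]\<close>)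
  moreover have "edge_count D n (?g v) (?g w) = edge_count D' n v w"
    if "v \<in> bverts D' n" "w \<in> bverts D' (Suc n)" for n v w
    using that f by (auto simp: onto[symmetric] gf same_transitions_def)
  ultimately have "same_transitions ?g D' D"
    by (simp add: same_transitions_def)
  then show ?thesis ..
qed

lemma path_count_same_transitions:
  assumes f: "same_transitions f D D'" and v: "v \<in> bverts D a" and w: "w \<in> bverts D (a + k)"
  shows "path_count D' a k (f v) (f w) = path_count D a k v w"
  using v w
proof (induction k arbitrary: a v)
  case 0
  then show ?case
    using f bij_betw_imp_inj_on[of f "bverts D a"]
    by (auto simp: same_transitions_def dest: inj_onD)
next
  case (Suc k)
  have bij: "bij_betw f (bverts D (Suc a)) (bverts D' (Suc a))"
    using f by (simp add: same_transitions_def)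
  have "path_count D' a (Suc k) (f v) (f w) =
      (\<Sum>u \<in> bverts D (Suc a). edge_count D' a (f v) (f u) * path_count D' (Suc a) k (f u) (f w))"
    by (simp add: sum.reindex_bij_betw[OF bij, symmetric])
  also have "\<dots> = path_count D a (Suc k) v w"
    using Suc f by (auto simp: same_transitions_def intro!: sum.cong)
  finally show ?case .
qed

section \<open>Simple diagrams\<close>

definition simple_diagram :: "('v, 'e) bratteli \<Rightarrow> bool" where
  "simple_diagram D \<longleftrightarrow>
     (\<forall>a. \<exists>k. \<forall>v \<in> bverts D a. \<forall>w \<in> bverts D (a + k). 0 < path_count D a k v w)"

lemma path_count_add_pos:
  assumes D: "bratteli_diagram D" and "v \<in> bverts D a" "u \<in> bverts D (a + k)"
    and "0 < path_count D a k v u" "0 < path_count D (a + k) l u w"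
  shows "0 < path_count D a (k + l) v w"
proof -
  have "0 < path_count D a k v u * path_count D (a + k) l u w"
    using assms by simp
  also have "\<dots> \<le> (\<Sum>u \<in> bverts D (a + k). path_count D a k v u * path_count D (a + k) l u w)"
    using assms diagram_finite[OF D] by (intro member_le_sum) auto
  finally show ?thesis
    by (simp add: path_count_add[OF assms(1,2)])
qed

lemma path_count_1:
  assumes D: "bratteli_diagram D" and "w \<in> bverts D (Suc a)"
  shows "path_count D a (Suc 0) v w = edge_count D a v w"
proof -
  have "path_count D a (Suc 0) v w = (\<Sum>u \<in> bverts D (Suc a). if u = w then edge_count D a v w else 0)"
    by (auto intro!: sum.cong)
  then show ?thesis
    using assms diagram_finite[OF D] by (simp add: sum.delta)
qed

lemma edge_count_pos:
  assumes D: "bratteli_diagram D" and "e \<in> bedges D (Suc a)"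
  shows "0 < edge_count D a (bsrc D e) (brng D e)"
  using assms diagram_finite(3)[OF D] by (auto simp: edge_count_def card_gt_0_iff)

lemma path_from:
  assumes D: "bratteli_diagram D" and "v \<in> bverts D a"
  shows "\<exists>w \<in> bverts D (a + k). 0 < path_count D a k v w"
  using assms(2)
proof (induction k arbitrary: a v)
  case (Suc k)
  obtain e where e: "e \<in> bedges D (Suc a)" "bsrc D e = v"
    using D Suc.prems unfolding bratteli_diagram_def by meson
  let ?u = "brng D e"
  have u: "?u \<in> bverts D (Suc a)"
    using diagram_ends(2)[OF D e(1)] .
  obtain w where w: "w \<in> bverts D (Suc a + k)" "0 < path_count D (Suc a) k ?u w"
    using Suc.IH[OF u] by blast
  have "0 < path_count D a (Suc 0 + k) v w"
    using path_count_add_pos[OF D Suc.prems, of ?u "Suc 0" k w] u w e edge_count_pos[OF D e(1)]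
    by (simp add: path_count_1[OF D u] del: path_count.simps(2))
  then show ?case
    using w by auto
qed auto

lemma path_to:
  assumes D: "bratteli_diagram D" and "w \<in> bverts D (a + k)"
  shows "\<exists>v \<in> bverts D a. 0 < path_count D a k v w"
  using assms(2)
proof (induction k arbitrary: a)
  case (Suc k)
  obtain u where u: "u \<in> bverts D (Suc a)" "0 < path_count D (Suc a) k u w"
    using Suc.IH[of "Suc a"] Suc.prems by auto
  obtain e where e: "e \<in> bedges D (Suc a)" "brng D e = u"
    using D u unfolding bratteli_diagram_def by meson
  let ?v = "bsrc D e"
  have v: "?v \<in> bverts D a"
    using diagram_ends(1)[OF D e(1)] .
  have "0 < path_count D a (Suc 0 + k) ?v w"
    using path_count_add_pos[OF D v, of u "Suc 0" k w] u e edge_count_pos[OF D e(1)]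
    by (simp add: path_count_1[OF D u(1)] del: path_count.simps(2))
  then show ?case
    using v by auto
qed auto

text \<open>A path into the later level passes through the earlier one, since every vertex is the range of
  an edge.\<close>

lemma connects_later:
  assumes D: "bratteli_diagram D"
    and k: "\<forall>v \<in> bverts D a. \<forall>w \<in> bverts D (a + k). 0 < path_count D a k v w"
    and v: "v \<in> bverts D a" and w: "w \<in> bverts D (a + k')" and le: "k \<le> k'"
  shows "0 < path_count D a k' v w"
proof -
  obtain u where u: "u \<in> bverts D (a + k)" "0 < path_count D (a + k) (k' - k) u w"
    using path_to[OF D, of w "a + k" "k' - k"] w le by auto
  then show ?thesis
    using path_count_add_pos[OF D v u(1) _ u(2)] k v u(1) le by simp
qed

lemma bverts_telescoping [simp]: "bverts (telescoping m D) n = bverts D (m n)"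
  by (simp add: telescoping_def)

text \<open>A level \<open>a\<close> that telescoping may have dropped is joined to the retained level \<open>m a\<close> first,
  where \<open>a \<le> m a\<close>. In the other direction complete connection persists at later levels.\<close>

lemma simple_telescoping:
  assumes D: "bratteli_diagram D" and m: "strict_mono m"
  shows "simple_diagram (telescoping m D) \<longleftrightarrow> simple_diagram D"
proof
  assume T: "simple_diagram (telescoping m D)"
  show "simple_diagram D"
    unfolding simple_diagram_def
  proof
    fix a
    obtain j where j: "\<forall>v \<in> bverts D (m a). \<forall>w \<in> bverts D (m (a + j)).
        0 < path_count D (m a) (m (a + j) - m a) v w"
      using T[unfolded simple_diagram_def, rule_format, of a]
      by (auto simp: path_count_telescoping[OF D m])
    have le: "a \<le> m a" "m a \<le> m (a + j)"
      using m by (simp_all add: strict_mono_imp_increasing strict_mono_less_eq)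
    have "0 < path_count D a (m (a + j) - a) v w"
      if v: "v \<in> bverts D a" and w: "w \<in> bverts D (m (a + j))" for v w
    proof -
      obtain u where "u \<in> bverts D (m a)" "0 < path_count D a (m a - a) v u"
        using path_from[OF D v, of "m a - a"] le by auto
      then show ?thesis
        using path_count_add_pos[OF D v, of u "m a - a" "m (a + j) - m a" w] j w le by simp
    qed
    then show "\<exists>k. \<forall>v \<in> bverts D a. \<forall>w \<in> bverts D (a + k). 0 < path_count D a k v w"
      using le by (intro exI[of _ "m (a + j) - a"]) auto
  qed
next
  assume S: "simple_diagram D"
  show "simple_diagram (telescoping m D)"
    unfolding simple_diagram_def
  proof
    fix n
    obtain k where k: "\<forall>v \<in> bverts D (m n). \<forall>w \<in> bverts D (m n + k). 0 < path_count D (m n) k v w"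
      using S[unfolded simple_diagram_def] by blast
    have "m n + k \<le> m (n + k)"
    proof (induction k)
      case (Suc k)
      then show ?case
        using strict_monoD[OF m, of "n + k" "n + Suc k"] by simp
    qed simp
    then have "0 < path_count D (m n) (m (n + k) - m n) v w"
      if "v \<in> bverts D (m n)" "w \<in> bverts D (m (n + k))" for v w
      using connects_later[OF D k] that by simp
    then show "\<exists>k. \<forall>v \<in> bverts (telescoping m D) n. \<forall>w \<in> bverts (telescoping m D) (n + k).
        0 < path_count (telescoping m D) n k v w"
      by (intro exI[of _ k]) (simp add: path_count_telescoping[OF D m])
  qed
qed

lemma simple_same_transitions:
  assumes f: "same_transitions f D D'" and S: "simple_diagram D'"
  shows "simple_diagram D"
  unfolding simple_diagram_def
proof
  fix a
  obtain k where "\<forall>v \<in> bverts D' a. \<forall>w \<in> bverts D' (a + k). 0 < path_count D' a k v w"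
    using S[unfolded simple_diagram_def] by blast
  moreover have "f v \<in> bverts D' n" if "v \<in> bverts D n" for n v
    using f that bij_betwE unfolding same_transitions_def by blast
  ultimately have "\<forall>v \<in> bverts D a. \<forall>w \<in> bverts D (a + k). 0 < path_count D a k v w"
    using path_count_same_transitions[OF f] by metis
  then show "\<exists>k. \<forall>v \<in> bverts D a. \<forall>w \<in> bverts D (a + k). 0 < path_count D a k v w" ..
qed

section \<open>Positive rational traces\<close>

text \<open>These are the strictly positive rational-valued states, up to scaling, of the dimension group of
  the diagram. Strict positivity is preserved by restriction to a telescoping without
  further argument; on simple diagrams it holds for every nonzero nonnegative trace.\<close>

definition positive_rational_trace :: "('v, 'e) bratteli \<Rightarrow> ('v \<Rightarrow> rat) \<Rightarrow> bool" where
  "positive_rational_trace D x \<longleftrightarrow>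
     (\<forall>n. \<forall>v \<in> bverts D n. 0 < x v \<and>
        x v = (\<Sum>w \<in> bverts D (Suc n). of_nat (edge_count D n v w) * x w))"

lemma trace_pos: "positive_rational_trace D x \<Longrightarrow> v \<in> bverts D n \<Longrightarrow> 0 < x v"
  unfolding positive_rational_trace_def by blast

lemma trace_eq:
  "positive_rational_trace D x \<Longrightarrow> v \<in> bverts D n \<Longrightarrow>
     x v = (\<Sum>w \<in> bverts D (Suc n). of_nat (edge_count D n v w) * x w)"
  unfolding positive_rational_trace_def by blast

lemma trace_same_transitions:
  assumes f: "same_transitions f D D'" and x: "positive_rational_trace D' x"
  shows "positive_rational_trace D (x \<circ> f)"
proof -
  have bij: "bij_betw f (bverts D n) (bverts D' n)" for n
    using f by (simp add: same_transitions_def)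
  have "0 < x (f v) \<and> x (f v) = (\<Sum>w \<in> bverts D (Suc n). of_nat (edge_count D n v w) * x (f w))"
    if v: "v \<in> bverts D n" for n v
  proof -
    have "(\<Sum>w \<in> bverts D (Suc n). of_nat (edge_count D n v w) * x (f w)) =
        (\<Sum>w \<in> bverts D (Suc n). of_nat (edge_count D' n (f v) (f w)) * x (f w))"
      using f v by (intro sum.cong) (auto simp: same_transitions_def)
    also have "\<dots> = (\<Sum>w \<in> bverts D' (Suc n). of_nat (edge_count D' n (f v) w) * x w)"
      by (rule sum.reindex_bij_betw[OF bij])
    finally have eq: "(\<Sum>w \<in> bverts D (Suc n). of_nat (edge_count D n v w) * x (f w)) = \<dots>" .
    have fv: "f v \<in> bverts D' n"
      using bij_betwE[OF bij] v by blast
    show ?thesis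
      by (intro conjI trace_pos[OF x fv] trans[OF trace_eq[OF x fv] eq[symmetric]])
  qed
  then show ?thesis
    unfolding positive_rational_trace_def o_def by blast
qed

lemma trace_along_paths:
  assumes x: "positive_rational_trace D x" and D: "bratteli_diagram D" and v: "v \<in> bverts D a"
  shows "x v = (\<Sum>w \<in> bverts D (a + k). of_nat (path_count D a k v w) * x w)"
  using v
proof (induction k arbitrary: a v)
  case 0
  have "(\<Sum>w \<in> bverts D a. of_nat (path_count D a 0 v w) * x w) =
      (\<Sum>w \<in> bverts D a. if v = w then x w else 0)"
    by (rule sum.cong) auto
  then show ?case
    using 0 diagram_finite[OF D] by (simp add: sum.delta)
next
  case (Suc k)
  have "x v = (\<Sum>u \<in> bverts D (Suc a). of_nat (edge_count D a v u) * x u)"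
    by (rule trace_eq[OF x Suc.prems])
  also have "\<dots> = (\<Sum>u \<in> bverts D (Suc a). of_nat (edge_count D a v u) *
      (\<Sum>w \<in> bverts D (Suc a + k). of_nat (path_count D (Suc a) k u w) * x w))"
    by (intro sum.cong refl arg_cong2[where f = "(*)"] Suc.IH)
  also have "\<dots> = (\<Sum>w \<in> bverts D (Suc a + k). \<Sum>u \<in> bverts D (Suc a).
      of_nat (edge_count D a v u) * of_nat (path_count D (Suc a) k u w) * x w)"
    unfolding sum_distrib_left by (subst sum.swap) (simp add: mult.assoc)
  also have "\<dots> = (\<Sum>w \<in> bverts D (a + Suc k). of_nat (path_count D a (Suc k) v w) * x w)"
    by (simp add: sum_distrib_right)
  finally show ?case .
qed

text \<open>A trace on the telescoping determines the value at any vertex \<open>v\<close> of level \<open>a\<close>: sum over the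
  paths from \<open>v\<close> to a retained level \<open>m n\<close>. The result \<open>F a n v\<close> does not depend on \<open>n\<close>.\<close>

lemma trace_telescoping:
  assumes D: "bratteli_diagram D" and m: "strict_mono m"
  shows "(\<exists>x. positive_rational_trace (telescoping m D) x) \<longleftrightarrow> (\<exists>x. positive_rational_trace D x)"
proof
  assume "\<exists>x. positive_rational_trace D x"
  then obtain x where x: "positive_rational_trace D x" ..
  have "x v = (\<Sum>w \<in> bverts D (m (Suc n)). of_nat (edge_count (telescoping m D) n v w) * x w)"
    if v: "v \<in> bverts D (m n)" for n v
    using trace_along_paths[OF x D v, of "m (Suc n) - m n"] strict_monoD[OF m, of n "Suc n"]
    by (simp add: edge_count_telescoping[OF D m v])
  then have "positive_rational_trace (telescoping m D) x"
    unfolding positive_rational_trace_def bverts_telescoping using trace_pos[OF x] by blast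
  then show "\<exists>x. positive_rational_trace (telescoping m D) x"
    by blast
next
  assume "\<exists>x. positive_rational_trace (telescoping m D) x"
  then obtain y where y: "positive_rational_trace (telescoping m D) y" ..
  have le: "a \<le> m a" "m a \<le> m (Suc a)" for a
    using m by (simp_all add: strict_mono_imp_increasing strict_mono_less_eq)
  define F where "F a n v = (\<Sum>w \<in> bverts D (m n). of_nat (path_count D a (m n - a) v w) * y w)"
    for a n v
  have F_Suc: "F a n v = F a (Suc n) v" if v: "v \<in> bverts D a" and an: "a \<le> m n" for a n v
  proof -
    have add: "path_count D a ((m n - a) + l) v u =
        (\<Sum>w \<in> bverts D (m n). path_count D a (m n - a) v w * path_count D (m n) l w u)" for l u
      by (subst path_count_add[OF D v]) (simp add: an)
    have "F a n v = (\<Sum>w \<in> bverts D (m n). of_nat (path_count D a (m n - a) v w) *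
       (\<Sum>u \<in> bverts D (m (Suc n)). of_nat (path_count D (m n) (m (Suc n) - m n) w u) * y u))"
      unfolding F_def
    proof (intro sum.cong refl arg_cong2[where f = "(*)"])
      fix w assume w: "w \<in> bverts D (m n)"
      show "y w = (\<Sum>u \<in> bverts D (m (Suc n)).
          of_nat (path_count D (m n) (m (Suc n) - m n) w u) * y u)"
        using trace_eq[OF y, of w n] w edge_count_telescoping[OF D m w] by simp
    qed
    also have "\<dots> = (\<Sum>u \<in> bverts D (m (Suc n)). \<Sum>w \<in> bverts D (m n).
       of_nat (path_count D a (m n - a) v w) * of_nat (path_count D (m n) (m (Suc n) - m n) w u) * y u)"
      unfolding sum_distrib_left by (subst sum.swap) (simp add: mult.assoc)
    also have "\<dots> = (\<Sum>u \<in> bverts D (m (Suc n)).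
       of_nat (path_count D a ((m n - a) + (m (Suc n) - m n)) v u) * y u)"
      unfolding add by (simp add: sum_distrib_right)
    also have "(m n - a) + (m (Suc n) - m n) = m (Suc n) - a"
      using an le[of n] by simp
    finally show ?thesis
      by (simp add: F_def)
  qed
  \<comment> \<open>The choice \<open>n = a\<close> is possible because \<open>a \<le> m a\<close>.\<close>
  define x where "x v = (let a = (THE a. v \<in> bverts D a) in F a a v)" for v
  have x: "x v = F a a v" if "v \<in> bverts D a" for a v
  proof -
    have "(THE a. v \<in> bverts D a) = a"
      using that diagram_level_unique[OF D] by blast
    then show ?thesis
      by (simp add: x_def)
  qed
  have "0 < x v \<and> x v = (\<Sum>w \<in> bverts D (Suc a). of_nat (edge_count D a v w) * x w)"
    if v: "v \<in> bverts D a" for a v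
  proof
    have pos: "0 < y w" if "w \<in> bverts D (m a)" for w
      using trace_pos[OF y] that by simp
    obtain w where w: "w \<in> bverts D (m a)" "0 < path_count D a (m a - a) v w"
      using path_from[OF D v, of "m a - a"] le[of a] by auto
    then show "0 < x v"
      unfolding x[OF v] F_def using pos diagram_finite[OF D]
      by (intro sum_pos2[of _ w]) (auto intro!: mult_nonneg_nonneg intro: less_imp_le)
    have "x v = F a (Suc a) v"
      using x[OF v] F_Suc[OF v, of a] le(1)[of a] by simp
    also have "\<dots> = (\<Sum>u \<in> bverts D (m (Suc a)).
        of_nat (path_count D a (Suc (m (Suc a) - Suc a)) v u) * y u)"
      using le(1)[of "Suc a"] by (simp add: F_def Suc_diff_Suc del: path_count.simps(2))
    also have "\<dots> = (\<Sum>u \<in> bverts D (m (Suc a)). \<Sum>w \<in> bverts D (Suc a).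
        of_nat (edge_count D a v w) * (of_nat (path_count D (Suc a) (m (Suc a) - Suc a) w u) * y u))"
      by (simp add: sum_distrib_right mult.assoc)
    also have "\<dots> = (\<Sum>w \<in> bverts D (Suc a). of_nat (edge_count D a v w) * F (Suc a) (Suc a) w)"
      by (subst sum.swap) (simp add: F_def sum_distrib_left)
    also have "\<dots> = (\<Sum>w \<in> bverts D (Suc a). of_nat (edge_count D a v w) * x w)"
      using x by simp
    finally show "x v = \<dots>" .
  qed
  then have "positive_rational_trace D x"
    unfolding positive_rational_trace_def by blast
  then show "\<exists>x. positive_rational_trace D x"
    by blast
qed

section \<open>Invariance under telescope equivalence\<close>

lemma same_transitions_invariants:
  assumes f: "same_transitions f D D'" and D': "bratteli_diagram D'"
  shows "simple_diagram D \<longleftrightarrow> simple_diagram D'"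
    and "(\<exists>x. positive_rational_trace D x) \<longleftrightarrow> (\<exists>x. positive_rational_trace D' x)"
proof -
  obtain g where g: "same_transitions g D' D"
    using same_transitions_sym[OF f] D' unfolding bratteli_diagram_def by blast
  show "simple_diagram D \<longleftrightarrow> simple_diagram D'"
    using simple_same_transitions[OF f] simple_same_transitions[OF g] by blast
  show "(\<exists>x. positive_rational_trace D x) \<longleftrightarrow> (\<exists>x. positive_rational_trace D' x)"
    using trace_same_transitions[OF f] trace_same_transitions[OF g] by blast
qed

lemma iso_invariants:
  assumes "bratteli_iso D D'" "bratteli_diagram D" "bratteli_diagram D'"
  shows "simple_diagram D \<longleftrightarrow> simple_diagram D'"
    and "(\<exists>x. positive_rational_trace D x) \<longleftrightarrow> (\<exists>x. positive_rational_trace D' x)"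
proof -
  obtain f where f: "same_transitions f D D'"
    using same_transitions_iso[OF assms(1)] diagram_ends[OF assms(2)] by blast
  show "simple_diagram D \<longleftrightarrow> simple_diagram D'"
    "(\<exists>x. positive_rational_trace D x) \<longleftrightarrow> (\<exists>x. positive_rational_trace D' x)"
    using same_transitions_invariants[OF f assms(3)] by blast+
qed

lemma telescoping_ends:
  assumes D: "bratteli_diagram D" and m: "strict_mono m"
    and p: "p \<in> bedges (telescoping m D) (Suc n)"
  shows "bsrc (telescoping m D) p \<in> bverts (telescoping m D) n \<and>
    brng (telescoping m D) p \<in> bverts (telescoping m D) (Suc n)"
proof -
  have len: "length p = m (Suc n) - m n" and
    edge: "\<And>i. i < length p \<Longrightarrow> p ! i \<in> bedges D (Suc (m n + i))"
    using p by (auto simp: telescoping_def bratteli_paths_def)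
  have lt: "m n < m (Suc n)"
    using m by (simp add: strict_mono_less)
  then have "p \<noteq> []"
    using len by auto
  moreover have "bsrc D (p ! 0) \<in> bverts D (m n)"
    using diagram_ends(1)[OF D edge[of 0]] len lt by simp
  moreover have "brng D (p ! (length p - 1)) \<in> bverts D (m (Suc n))"
    using diagram_ends(2)[OF D edge[of "length p - 1"]] len lt by simp
  ultimately show ?thesis
    by (simp add: telescoping_def hd_conv_nth last_conv_nth)
qed

lemma telescoping_iso_invariants:
  assumes iso: "bratteli_iso (telescoping m D) D'" and m: "strict_mono m"
    and D: "bratteli_diagram D" and D': "bratteli_diagram D'"
  shows "simple_diagram D \<longleftrightarrow> simple_diagram D'"
    and "(\<exists>x. positive_rational_trace D x) \<longleftrightarrow> (\<exists>x. positive_rational_trace D' x)"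
proof -
  obtain f where f: "same_transitions f (telescoping m D) D'"
    using same_transitions_iso[OF iso] telescoping_ends[OF D m] by blast
  show "simple_diagram D \<longleftrightarrow> simple_diagram D'"
    "(\<exists>x. positive_rational_trace D x) \<longleftrightarrow> (\<exists>x. positive_rational_trace D' x)"
    using same_transitions_invariants[OF f D'] simple_telescoping[OF D m]
      trace_telescoping[OF D m] by blast+
qed

lemma telescope_equivalent_invariants:
  assumes "telescope_equivalent D D'" "bratteli_diagram D" "bratteli_diagram D'"
  shows "simple_diagram D \<longleftrightarrow> simple_diagram D'"
    and "(\<exists>x. positive_rational_trace D x) \<longleftrightarrow> (\<exists>x. positive_rational_trace D' x)"
proof -
  let ?same = "\<lambda>C C' :: (nat, nat) bratteli. (simple_diagram C \<longleftrightarrow> simple_diagram C') \<and>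
    ((\<exists>x. positive_rational_trace C x) \<longleftrightarrow> (\<exists>x. positive_rational_trace C' x))"
  have one_step: "?same C C'" if "telescope_step C C'" for C C'
    using that iso_invariants[of C C'] telescoping_iso_invariants[of _ C C']
      telescoping_iso_invariants[of _ C' C]
    unfolding telescope_step_def by blast
  have steps: "?same C C'" if "telescope_step\<^sup>*\<^sup>* C C'" for C C'
    using that
  proof induction
    case (step C' C'')
    then show ?case
      using one_step[OF step.hyps(2)] by blast
  qed blast
  obtain C C' :: "(nat, nat) bratteli" where C: "bratteli_diagram C" "bratteli_diagram C'"
    "bratteli_iso D C" "telescope_step\<^sup>*\<^sup>* C C'" "bratteli_iso C' D'"
    using assms(1) unfolding telescope_equivalent_def by blast
  show "simple_diagram D \<longleftrightarrow> simple_diagram D'"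
    "(\<exists>x. positive_rational_trace D x) \<longleftrightarrow> (\<exists>x. positive_rational_trace D' x)"
    using steps[OF C(4)] iso_invariants[OF C(3) assms(2) C(1)]
      iso_invariants[OF C(5) C(2) assms(3)] by blast+
qed

section \<open>Matrices acting on functions\<close>

text \<open>Functions on the naturals spare the dimension bookkeeping of vectors; only the values at
  arguments below the dimension matter.\<close>

definition mat_app :: "'a :: semiring_1 mat \<Rightarrow> (nat \<Rightarrow> 'a) \<Rightarrow> nat \<Rightarrow> 'a" where
  "mat_app A y i = (\<Sum>j < dim_col A. A $$ (i, j) * y j)"

lemma mat_app_mult_vec:
  assumes "A \<in> carrier_mat n n" "u \<in> carrier_vec n" "i < n"
  shows "(A *\<^sub>v u) $ i = mat_app A (($) u) i"
  using assms by (simp add: mat_app_def scalar_prod_def lessThan_atLeast0)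

lemma mat_app_cong:
  assumes "A \<in> carrier_mat n n" "\<And>j. j < n \<Longrightarrow> y j = z j"
  shows "mat_app A y i = mat_app A z i"
  using assms by (simp add: mat_app_def)

lemma mat_app_times:
  fixes A B :: "'a :: semiring_1 mat"
  assumes A: "A \<in> carrier_mat n n" and B: "B \<in> carrier_mat n n" and i: "i < n"
  shows "mat_app (A * B) y i = mat_app A (mat_app B y) i"
proof -
  have "mat_app (A * B) y i = (\<Sum>j<n. (\<Sum>l<n. A $$ (i, l) * B $$ (l, j)) * y j)"
    using assms by (auto simp: mat_app_def scalar_prod_def lessThan_atLeast0 intro!: sum.cong)
  also have "\<dots> = (\<Sum>l<n. \<Sum>j<n. A $$ (i, l) * B $$ (l, j) * y j)"
    unfolding sum_distrib_right by (rule sum.swap)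
  also have "\<dots> = mat_app A (mat_app B y) i"
    using assms by (simp add: mat_app_def sum_distrib_left mult.assoc)
  finally show ?thesis .
qed

lemma mat_app_one:
  assumes "i < n"
  shows "mat_app (1\<^sub>m n) y i = y i"
proof -
  have "mat_app (1\<^sub>m n) y i = (\<Sum>j<n. if i = j then y j else 0)"
    unfolding mat_app_def using assms by (intro sum.cong) auto
  then show ?thesis
    using assms by simp
qed

lemma pow_mat_Suc_left:
  fixes A :: "'a :: semiring_1 mat"
  assumes "A \<in> carrier_mat n n"
  shows "A ^\<^sub>m Suc m = A * A ^\<^sub>m m"
proof (induction m)
  case (Suc m)
  have "A ^\<^sub>m Suc (Suc m) = (A * A ^\<^sub>m m) * A"
    using Suc by simp
  also have "\<dots> = A * A ^\<^sub>m Suc m"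
    using assms by (simp add: assoc_mult_mat[of _ n n _ n _ n])
  finally show ?case .
qed (use assms in simp)

lemma mat_app_pow_eigen:
  fixes A :: "'a :: comm_semiring_1 mat"
  assumes A: "A \<in> carrier_mat n n" and y: "\<And>i. i < n \<Longrightarrow> mat_app A y i = t * y i" and "i < n"
  shows "mat_app (A ^\<^sub>m m) y i = t ^ m * y i"
  using \<open>i < n\<close>
proof (induction m arbitrary: i)
  case 0
  then show ?case using A by (simp add: mat_app_one)
next
  case (Suc m)
  have "mat_app (A ^\<^sub>m Suc m) y i = mat_app (A ^\<^sub>m m) (mat_app A y) i"
    using A Suc.prems by (simp add: mat_app_times[of _ n])
  also have "\<dots> = mat_app (A ^\<^sub>m m) (\<lambda>i. t * y i) i"
    by (rule mat_app_cong[of _ n]) (use A y in auto)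
  also have "\<dots> = t * mat_app (A ^\<^sub>m m) y i"
    by (simp add: mat_app_def sum_distrib_left mult.left_commute)
  finally show ?case
    using Suc by (simp add: mult.assoc)
qed

section \<open>Positive eigenvectors of primitive matrices\<close>

text \<open>After division by \<open>t\<close> the spectral radius is below 1, and the powers stay bounded.\<close>

lemma pow_mat_bounded_above_spectral_radius:
  fixes A :: "real mat"
  assumes A: "A \<in> carrier_mat n n" and t: "0 < t"
    and lt: "spectral_radius (map_mat complex_of_real A) < t"
  obtains c where "\<And>m i j. i < n \<Longrightarrow> j < n \<Longrightarrow> \<bar>(A ^\<^sub>m m) $$ (i, j)\<bar> \<le> c * t ^ m"
proof (cases "n = 0")
  case False
  let ?C = "map_mat complex_of_real A"
  let ?B = "complex_of_real (1 / t) \<cdot>\<^sub>m ?C"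
  have C: "?C \<in> carrier_mat n n" and B: "?B \<in> carrier_mat n n"
    using A by auto
  have "spectral_radius ?B \<in> norm ` spectrum ?B"
    using spectral_radius_mem_max(1)[OF B] False by simp
  then obtain \<mu> u where \<mu>: "spectral_radius ?B = norm \<mu>" and u: "eigenvector ?B u \<mu>"
    unfolding spectrum_def eigenvalue_def by auto
  have u': "u \<in> carrier_vec n" "u \<noteq> 0\<^sub>v n" "?B *\<^sub>v u = \<mu> \<cdot>\<^sub>v u"
    using u A unfolding eigenvector_def by simp_all
  have "?C *\<^sub>v u = (of_real t * \<mu>) \<cdot>\<^sub>v u"
  proof -
    have "?C *\<^sub>v u = of_real t \<cdot>\<^sub>v (?B *\<^sub>v u)"
      using C u'(1) t by (intro eq_vecI) (auto simp: scalar_prod_def sum_distrib_left)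
    then show ?thesis
      unfolding u'(3) by (simp add: smult_smult_assoc)
  qed
  then have "eigenvalue ?C (of_real t * \<mu>)"
    using u'(1,2) A unfolding eigenvalue_def eigenvector_def by (intro exI[of _ u]) simp
  then have le: "norm (of_real t * \<mu>) \<le> spectral_radius ?C"
    using spectral_radius_mem_max(2)[OF C] False unfolding spectrum_def by blast
  have "t * norm \<mu> = norm (of_real t * \<mu>)"
    using t by (simp add: norm_mult)
  then have "t * norm \<mu> < t * 1"
    using le lt by linarith
  then have "norm \<mu> < 1"
    unfolding mult_less_cancel_left_pos[OF t] .
  then have "spectral_radius ?B < 1"
    unfolding \<mu> .
  then obtain c where c: "\<And>m. norm_bound (?B ^\<^sub>m m) c"
    using spectral_radius_jnf_norm_bound_less_1_upper_triangular[OF B] by blast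
  have pow: "(?B ^\<^sub>m m) $$ (i, j) = of_real ((A ^\<^sub>m m) $$ (i, j) / t ^ m)"
    if "i < n" "j < n" for m i j
    using that
  proof (induction m arbitrary: i j)
    case (Suc m)
    have "(?B ^\<^sub>m Suc m) $$ (i, j) = (\<Sum>l<n. (?B ^\<^sub>m m) $$ (i, l) * ?B $$ (l, j))"
      using B A Suc.prems by (simp add: scalar_prod_def lessThan_atLeast0)
    also have "\<dots> = (\<Sum>l<n. of_real ((A ^\<^sub>m m) $$ (i, l) / t ^ m) * of_real (1 / t * A $$ (l, j)))"
      using A Suc by (intro sum.cong) auto
    also have "\<dots> = of_real ((\<Sum>l<n. (A ^\<^sub>m m) $$ (i, l) * A $$ (l, j)) / t ^ Suc m)"
      using t by (simp add: sum_divide_distrib mult.commute)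
    also have "(\<Sum>l<n. (A ^\<^sub>m m) $$ (i, l) * A $$ (l, j)) = (A ^\<^sub>m Suc m) $$ (i, j)"
      using A Suc.prems by (simp add: scalar_prod_def lessThan_atLeast0)
    finally show ?case .
  qed (use A in auto)
  have "\<bar>(A ^\<^sub>m m) $$ (i, j)\<bar> \<le> c * t ^ m" if "i < n" "j < n" for m i j
  proof -
    have "norm ((?B ^\<^sub>m m) $$ (i, j)) \<le> c"
      using c[of m] that B A unfolding norm_bound_def by simp
    then show ?thesis
      unfolding pow[OF that] norm_of_real using t by (simp add: divide_le_eq)
  qed
  then show ?thesis
    using that by blast
qed (use that in auto)


lemma mat_app_mono:
  fixes A :: "real mat"
  assumes "A \<in> carrier_mat n n" "\<And>j. j < n \<Longrightarrow> 0 \<le> A $$ (i, j)" "\<And>j. j < n \<Longrightarrow> y j \<le> z j"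
  shows "mat_app A y i \<le> mat_app A z i"
  using assms by (auto simp: mat_app_def intro!: sum_mono mult_left_mono)

lemma mat_app_pos:
  fixes A :: "real mat"
  assumes "A \<in> carrier_mat n n" "\<And>j. j < n \<Longrightarrow> 0 < A $$ (i, j)"
    and "\<And>j. j < n \<Longrightarrow> 0 \<le> y j" "l < n" "y l \<noteq> 0"
  shows "0 < mat_app A y i"
proof -
  have "0 < A $$ (i, l) * y l"
    using assms by (simp add: order_less_le)
  then show ?thesis
    unfolding mat_app_def using assms
    by (intro sum_pos2[of _ l]) (auto intro!: mult_nonneg_nonneg intro: less_imp_le)
qed

text \<open>Iterating the hypothesis, the powers of \<open>A\<close> grow at least like \<open>s ^ m\<close> on \<open>z\<close>, whereas they
  are bounded by a multiple of \<open>t ^ m\<close> for every \<open>t\<close> above the spectral radius.\<close>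

lemma spectral_radius_lower_bound:
  fixes A :: "real mat"
  assumes A: "A \<in> carrier_mat n n" and n: "0 < n"
    and nn: "\<And>i j. i < n \<Longrightarrow> j < n \<Longrightarrow> 0 \<le> A $$ (i, j)"
    and z: "\<And>i. i < n \<Longrightarrow> 0 < z i" and s: "0 \<le> s"
    and super: "\<And>i. i < n \<Longrightarrow> s * z i \<le> mat_app A z i"
  shows "s \<le> spectral_radius (map_mat complex_of_real A)"
proof (rule ccontr)
  let ?r = "spectral_radius (map_mat complex_of_real A)"
  assume "\<not> s \<le> ?r"
  then have lt: "?r < s" by simp
  have "0 \<le> ?r"
    using spectral_radius_mem_max(1)[of "map_mat complex_of_real A" n] A n by auto
  obtain t where t: "?r < t" "t < s"
    using dense[OF lt] by blast
  then have t0: "0 < t"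
    using \<open>0 \<le> ?r\<close> by simp
  obtain c where c: "\<And>m i j. i < n \<Longrightarrow> j < n \<Longrightarrow> \<bar>(A ^\<^sub>m m) $$ (i, j)\<bar> \<le> c * t ^ m"
    using pow_mat_bounded_above_spectral_radius[OF A t0 t(1)] by blast
  have low: "s ^ m * z i \<le> mat_app (A ^\<^sub>m m) z i" if "i < n" for m i
    using that
  proof (induction m arbitrary: i)
    case 0
    then show ?case using A by (simp add: mat_app_one)
  next
    case (Suc m)
    have "s ^ Suc m * z i = s ^ m * (s * z i)"
      by simp
    also have "\<dots> \<le> s ^ m * mat_app A z i"
      using super Suc.prems s by (intro mult_left_mono) auto
    also have "\<dots> = mat_app A (\<lambda>j. s ^ m * z j) i"
      by (simp add: mat_app_def sum_distrib_left mult.left_commute)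
    also have "\<dots> \<le> mat_app A (mat_app (A ^\<^sub>m m) z) i"
      by (rule mat_app_mono[OF A]) (use nn Suc in auto)
    also have "\<dots> = mat_app (A ^\<^sub>m Suc m) z i"
      unfolding pow_mat_Suc_left[OF A] using A Suc.prems by (simp add: mat_app_times[of _ n])
    finally show ?case .
  qed
  have up: "(s / t) ^ m \<le> c * (\<Sum>j<n. z j) / z 0" for m
  proof -
    have "mat_app (A ^\<^sub>m m) z 0 \<le> (\<Sum>j<n. c * t ^ m * z j)"
      unfolding mat_app_def using A n z c[of 0 _ m]
      by (auto intro!: sum_mono mult_right_mono less_imp_le[OF z] intro: order_trans[OF abs_ge_self])
    also have "\<dots> = c * t ^ m * (\<Sum>j<n. z j)"
      by (simp add: sum_distrib_left)
    finally have "s ^ m * z 0 \<le> c * t ^ m * (\<Sum>j<n. z j)"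
      using low[OF n, of m] by simp
    then show ?thesis
      using z[OF n] t0 by (simp add: field_simps)
  qed
  have "1 < s / t"
    using t t0 by simp
  then obtain m where "c * (\<Sum>j<n. z j) / z 0 < (s / t) ^ m"
    using real_arch_pow by blast
  with up[of m] show False
    by simp
qed

text \<open>Take an eigenvector \<open>u\<close> whose eigenvalue has maximal modulus \<open>r\<close>. By the triangle inequality
  \<open>y = \<bar>u\<bar>\<close> satisfies \<open>r y \<le> A y\<close>. If equality failed somewhere, the positive power \<open>P\<close> of
  \<open>A\<close> would turn the defect into a positive vector, so \<open>z = P y\<close> would satisfy
  \<open>(r + \<epsilon>) z \<le> A z\<close>, against the maximality of \<open>r\<close>. Hence \<open>y\<close> is an eigenvector, and
  \<open>P y = r ^ k y\<close> shows that \<open>y\<close> and \<open>r\<close> are positive.\<close>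

theorem perron_vector:
  fixes A :: "real mat"
  assumes A: "A \<in> carrier_mat n n" and n: "0 < n" and k: "1 \<le> k"
    and nn: "\<And>i j. i < n \<Longrightarrow> j < n \<Longrightarrow> 0 \<le> A $$ (i, j)"
    and pos: "\<And>i j. i < n \<Longrightarrow> j < n \<Longrightarrow> 0 < (A ^\<^sub>m k) $$ (i, j)"
  obtains \<theta> v where "0 < \<theta>" "\<And>i. i < n \<Longrightarrow> 0 < v i" "\<And>i. i < n \<Longrightarrow> mat_app A v i = \<theta> * v i"
proof -
  let ?C = "map_mat complex_of_real A"
  let ?P = "A ^\<^sub>m k"
  define r where "r = spectral_radius ?C"
  have C: "?C \<in> carrier_mat n n" and P: "?P \<in> carrier_mat n n"
    using A by auto
  obtain \<mu> u where \<mu>: "r = cmod \<mu>" and "eigenvector ?C u \<mu>"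
    using spectral_radius_mem_max(1)[OF C n] unfolding r_def spectrum_def eigenvalue_def by auto
  then have u: "u \<in> carrier_vec n" "u \<noteq> 0\<^sub>v n" "?C *\<^sub>v u = \<mu> \<cdot>\<^sub>v u"
    using A unfolding eigenvector_def by simp_all
  define y where "y i = cmod (u $ i)" for i
  obtain l where l: "l < n" "y l \<noteq> 0"
    using u(1,2) unfolding y_def by (metis carrier_vecD eq_vecI index_zero_vec norm_eq_zero)
  have y: "0 \<le> y i" for i
    by (simp add: y_def)
  have "0 \<le> r"
    by (simp add: \<mu>)
  have sub: "r * y i \<le> mat_app A y i" if i: "i < n" for i
  proof -
    have "\<mu> * u $ i = mat_app ?C (($) u) i"
      using arg_cong[OF u(3), of "\<lambda>x. x $ i"] u(1) i by (simp add: mat_app_mult_vec[OF C u(1) i])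
    also have "\<dots> = (\<Sum>j<n. of_real (A $$ (i, j)) * u $ j)"
      using A i by (simp add: mat_app_def)
    finally have "r * y i = cmod (\<Sum>j<n. of_real (A $$ (i, j)) * u $ j)"
      by (simp add: \<mu> y_def norm_mult[symmetric])
    also have "\<dots> \<le> (\<Sum>j<n. cmod (of_real (A $$ (i, j)) * u $ j))"
      by (rule norm_sum)
    also have "\<dots> = mat_app A y i"
      using A i nn by (simp add: mat_app_def y_def norm_mult)
    finally show ?thesis .
  qed
  define z where "z = mat_app ?P y"
  have z: "0 < z i" if "i < n" for i
    unfolding z_def by (rule mat_app_pos[where l = l, OF P pos[OF that]]) (use y l in auto)
  have Az: "mat_app A z i = mat_app ?P (mat_app A y) i" if "i < n" for i
    using mat_app_times[OF A P that, of y] mat_app_times[OF P A that, of y] pow_mat_Suc_left[OF A, of k]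
    by (simp add: z_def)
  have eq: "mat_app A y i = r * y i" if i: "i < n" for i
  proof (rule ccontr)
    assume ne: "mat_app A y i \<noteq> r * y i"
    define d where "d i = mat_app A y i - r * y i" for i
    have Pd: "0 < mat_app ?P d j" if "j < n" for j
      by (rule mat_app_pos[where l = i, OF P pos[OF that]]) (use i sub ne d_def in auto)
    define \<epsilon> where "\<epsilon> = Min ((\<lambda>j. mat_app ?P d j / z j) ` {..<n})"
    have "0 < \<epsilon>"
      unfolding \<epsilon>_def using n Pd z by (subst Min_gr_iff) auto
    have "r + \<epsilon> \<le> spectral_radius ?C"
    proof (rule spectral_radius_lower_bound[OF A n nn z])
      show "0 \<le> r + \<epsilon>"
        using \<open>0 \<le> r\<close> \<open>0 < \<epsilon>\<close> by simp
      fix j assume j: "j < n"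
      have "\<epsilon> \<le> mat_app ?P d j / z j"
        unfolding \<epsilon>_def using j by (intro Min_le) auto
      then have "\<epsilon> * z j \<le> mat_app ?P d j"
        using z[OF j] by (simp add: le_divide_eq)
      also have "mat_app ?P d j = mat_app A z j - r * z j"
        unfolding Az[OF j] by (simp add: d_def z_def mat_app_def sum_subtractf right_diff_distrib
            sum_distrib_left mult.left_commute)
      finally show "(r + \<epsilon>) * z j \<le> mat_app A z j"
        by (simp add: distrib_right)
    qed
    with \<open>0 < \<epsilon>\<close> show False
      by (simp add: r_def)
  qed
  have "z i = r ^ k * y i" if "i < n" for i
    unfolding z_def using mat_app_pow_eigen[OF A eq that] .
  then have zy: "0 < r ^ k * y i" if "i < n" for i
    using z that by metis
  have "r \<noteq> 0"
    using zy[OF n] k by (auto simp: power_0_left)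
  then have "0 < r"
    using \<open>0 \<le> r\<close> by simp
  moreover have "0 < y i" if "i < n" for i
    using zy[OF that] \<open>0 < r\<close> by (simp add: zero_less_mult_iff)
  ultimately show ?thesis
    using that eq by blast
qed


section \<open>Dominance, simplicity and uniqueness of the trace\<close>

lemma abs_diff_le_add: "0 \<le> a \<Longrightarrow> 0 \<le> b \<Longrightarrow> \<bar>a - b\<bar> \<le> a + (b :: real)"
  by linarith

text \<open>The outcome of \<open>perron_vector\<close> for a matrix and for its transpose; the two eigenvalues coincide,
  as \<open>primitive_perron_data\<close> shows.\<close>

locale perron_data =
  fixes n k :: nat and A :: "real mat" and \<theta> :: real and v w :: "nat \<Rightarrow> real"
  assumes A: "A \<in> carrier_mat n n" and n: "0 < n"
    and pos: "\<And>i j. i < n \<Longrightarrow> j < n \<Longrightarrow> 0 < (A ^\<^sub>m k) $$ (i, j)"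
    and \<theta>: "0 < \<theta>"
    and v: "\<And>i. i < n \<Longrightarrow> 0 < v i" "\<And>i. i < n \<Longrightarrow> mat_app A v i = \<theta> * v i"
    and w: "\<And>i. i < n \<Longrightarrow> 0 < w i" "\<And>j. j < n \<Longrightarrow> (\<Sum>i<n. w i * A $$ (i, j)) = \<theta> * w j"
begin

abbreviation "C \<equiv> map_mat complex_of_real A"

definition wsum :: "(nat \<Rightarrow> complex) \<Rightarrow> complex" where
  "wsum u = (\<Sum>i<n. complex_of_real (w i) * u i)"

definition wnorm :: "(nat \<Rightarrow> complex) \<Rightarrow> real" where
  "wnorm u = (\<Sum>i<n. w i * cmod (u i))"

lemma C_carrier: "C \<in> carrier_mat n n"
  using A by simp

lemma w_pow:
  assumes "j < n"
  shows "(\<Sum>i<n. w i * (A ^\<^sub>m m) $$ (i, j)) = \<theta> ^ m * w j"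
  using assms
proof (induction m arbitrary: j)
  case 0
  have "(\<Sum>i<n. w i * (A ^\<^sub>m 0) $$ (i, j)) = (\<Sum>i<n. if i = j then w i else 0)"
    using A 0 by (intro sum.cong) auto
  then show ?case
    using 0 by simp
next
  case (Suc m)
  have "(\<Sum>i<n. w i * (A ^\<^sub>m Suc m) $$ (i, j)) =
      (\<Sum>i<n. \<Sum>l<n. w i * ((A ^\<^sub>m m) $$ (i, l) * A $$ (l, j)))"
    using A Suc.prems by (simp add: scalar_prod_def lessThan_atLeast0 sum_distrib_left)
  also have "\<dots> = (\<Sum>l<n. (\<Sum>i<n. w i * (A ^\<^sub>m m) $$ (i, l)) * A $$ (l, j))"
    by (subst sum.swap) (simp add: sum_distrib_right mult.assoc)
  also have "\<dots> = \<theta> ^ m * (\<Sum>l<n. w l * A $$ (l, j))"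
    using Suc.IH by (simp add: sum_distrib_left mult.assoc)
  finally show ?case
    using w(2)[OF Suc.prems] by simp
qed

lemma wsum_app: "wsum (mat_app C u) = complex_of_real \<theta> * wsum u"
proof -
  have "wsum (mat_app C u) =
      (\<Sum>i<n. \<Sum>j<n. complex_of_real (w i) * (complex_of_real (A $$ (i, j)) * u j))"
    using A by (simp add: wsum_def mat_app_def sum_distrib_left)
  also have "\<dots> = (\<Sum>j<n. complex_of_real (\<Sum>i<n. w i * A $$ (i, j)) * u j)"
    by (subst sum.swap) (simp add: sum_distrib_right mult.assoc)
  also have "\<dots> = complex_of_real \<theta> * wsum u"
    using w(2) by (simp add: wsum_def sum_distrib_left mult.assoc)
  finally show ?thesis .
qed

lemma wsum_cong: "(\<And>i. i < n \<Longrightarrow> u i = u' i) \<Longrightarrow> wsum u = wsum u'"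
  by (simp add: wsum_def)

lemma wsum_v_nonzero: "wsum (\<lambda>i. of_real (v i)) \<noteq> 0"
proof -
  have "0 < (\<Sum>i<n. w i * v i)"
    using n v(1) w(1) by (intro sum_pos) auto
  moreover have "wsum (\<lambda>i. of_real (v i)) = of_real (\<Sum>i<n. w i * v i)"
    by (simp add: wsum_def)
  ultimately show ?thesis
    by (metis of_real_eq_0_iff less_irrefl)
qed

lemma app_v: "i < n \<Longrightarrow> mat_app C (\<lambda>i. of_real (v i)) i = of_real \<theta> * of_real (v i)"
  using A v(2)[of i, symmetric] unfolding of_real_mult[symmetric] by (simp add: mat_app_def)

lemma wnorm_nonneg: "0 \<le> wnorm u"
  unfolding wnorm_def using w(1) by (intro sum_nonneg mult_nonneg_nonneg) (auto intro: less_imp_le)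

lemma wnorm_zero: "wnorm u \<le> 0 \<Longrightarrow> i < n \<Longrightarrow> u i = 0"
proof -
  assume le: "wnorm u \<le> 0" and i: "i < n"
  have "w i * cmod (u i) \<le> wnorm u"
    unfolding wnorm_def using w(1) i
    by (intro member_le_sum) (auto intro!: mult_nonneg_nonneg intro: less_imp_le)
  then have "w i * cmod (u i) \<le> 0"
    using le by simp
  then show "u i = 0"
    using w(1)[OF i] by (simp add: mult_le_0_iff)
qed

text \<open>Subtracting from every row of \<open>A ^ k\<close> the small multiple \<open>\<epsilon> w\<close> keeps the entries nonnegative
  and, on vectors orthogonal to \<open>w\<close>, changes nothing. The reduced matrix still has \<open>w\<close> as a left
  eigenvector, with the eigenvalue \<open>\<theta> ^ k\<close> lowered by \<open>\<epsilon>\<close> times the sum of \<open>w\<close>. This is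
  Doeblin's argument for Markov chains.\<close>

lemma contraction:
  obtains \<rho> where "0 \<le> \<rho>" "\<rho> < 1"
    "\<And>u. wsum u = 0 \<Longrightarrow> wnorm (mat_app (C ^\<^sub>m k) u) \<le> \<rho> * \<theta> ^ k * wnorm u"
proof -
  let ?a = "\<lambda>i j. (A ^\<^sub>m k) $$ (i, j)"
  define \<epsilon> where "\<epsilon> = Min ((\<lambda>(i, j). ?a i j / w j) ` ({..<n} \<times> {..<n}))"
  have \<epsilon>: "0 < \<epsilon>"
    unfolding \<epsilon>_def using n pos w(1) by (subst Min_gr_iff) auto
  have \<epsilon>_le: "\<epsilon> * w j \<le> ?a i j" if "i < n" "j < n" for i j
  proof -
    have "\<epsilon> \<le> ?a i j / w j"
      unfolding \<epsilon>_def using that by (intro Min_le) auto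
    then show ?thesis
      using w(1)[OF that(2)] by (simp add: le_divide_eq)
  qed
  define W where "W = (\<Sum>i<n. w i)"
  have W: "0 < W"
    unfolding W_def using n w(1) by (intro sum_pos) auto
  have tk: "0 < \<theta> ^ k"
    using \<theta> by simp
  define \<rho> where "\<rho> = 1 - \<epsilon> * W / \<theta> ^ k"
  have Ck: "mat_app (C ^\<^sub>m k) u i = (\<Sum>j<n. of_real (?a i j) * u j)" if "i < n" for u i
  proof -
    have "C ^\<^sub>m k = map_mat complex_of_real (A ^\<^sub>m k)"
      by (rule of_real_hom.mat_hom_pow[OF A, symmetric])
    then show ?thesis
      using A that by (simp add: mat_app_def)
  qed
  have contract: "wnorm (mat_app (C ^\<^sub>m k) u) \<le> \<rho> * \<theta> ^ k * wnorm u" if u: "wsum u = 0" for u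
  proof -
    have "cmod (mat_app (C ^\<^sub>m k) u i) \<le> (\<Sum>j<n. (?a i j - \<epsilon> * w j) * cmod (u j))" if i: "i < n" for i
    proof -
      have "mat_app (C ^\<^sub>m k) u i = mat_app (C ^\<^sub>m k) u i - of_real \<epsilon> * wsum u"
        using u by simp
      also have "\<dots> = (\<Sum>j<n. of_real (?a i j - \<epsilon> * w j) * u j)"
        unfolding Ck[OF i] wsum_def sum_distrib_left sum_subtractf[symmetric]
        by (simp add: algebra_simps)
      finally have "cmod (mat_app (C ^\<^sub>m k) u i) \<le> (\<Sum>j<n. cmod (of_real (?a i j - \<epsilon> * w j) * u j))"
        by (metis norm_sum)
      also have "\<dots> = (\<Sum>j<n. (?a i j - \<epsilon> * w j) * cmod (u j))"
        using \<epsilon>_le[OF i] by (intro sum.cong refl) (simp only: norm_mult norm_of_real, simp)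
      finally show ?thesis .
    qed
    then have "wnorm (mat_app (C ^\<^sub>m k) u) \<le>
        (\<Sum>i<n. w i * (\<Sum>j<n. (?a i j - \<epsilon> * w j) * cmod (u j)))"
      unfolding wnorm_def using w(1) by (intro sum_mono mult_left_mono) (auto intro: less_imp_le)
    also have "\<dots> = (\<Sum>j<n. \<Sum>i<n. w i * ((?a i j - \<epsilon> * w j) * cmod (u j)))"
      unfolding sum_distrib_left by (rule sum.swap)
    also have "\<dots> = (\<Sum>j<n. ((\<Sum>i<n. w i * ?a i j) - \<epsilon> * W * w j) * cmod (u j))"
      by (intro sum.cong refl)
        (simp add: W_def sum_distrib_left sum_distrib_right sum_subtractf[symmetric] algebra_simps)
    also have "\<dots> = (\<Sum>j<n. (\<theta> ^ k - \<epsilon> * W) * (w j * cmod (u j)))"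
      using w_pow by (intro sum.cong refl) (simp add: algebra_simps)
    also have "\<dots> = (\<theta> ^ k - \<epsilon> * W) * wnorm u"
      by (simp add: wnorm_def sum_distrib_left)
    also have "\<theta> ^ k - \<epsilon> * W = \<rho> * \<theta> ^ k"
      using \<theta> by (simp add: \<rho>_def left_diff_distrib)
    finally show ?thesis .
  qed
  have "\<epsilon> * W * w 0 = (\<Sum>i<n. w i * (\<epsilon> * w 0))"
    by (simp add: W_def sum_distrib_left sum_distrib_right mult_ac)
  also have "\<dots> \<le> (\<Sum>i<n. w i * ?a i 0)"
    using \<epsilon>_le n w(1) by (intro sum_mono mult_left_mono) (auto intro: less_imp_le)
  also have "\<dots> = \<theta> ^ k * w 0"
    using w_pow n by simp
  finally have "\<epsilon> * W \<le> \<theta> ^ k"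
    using w(1)[OF n] by simp
  then have "0 \<le> \<rho>"
    using tk by (simp add: \<rho>_def)
  moreover have "\<rho> < 1"
    using \<epsilon> W tk by (simp add: \<rho>_def)
  ultimately show ?thesis
    using that contract by blast
qed

text \<open>Following the orbit \<open>j * k\<close> steps and coming back by \<open>A ^ (j * k)\<close> bounds the norm of \<open>z 0\<close> by
  \<open>\<rho> ^ j * B\<close>.\<close>

lemma backward_orbit_zero:
  fixes z :: "nat \<Rightarrow> nat \<Rightarrow> complex"
  assumes orbit: "\<And>s i. i < n \<Longrightarrow> z s i = mat_app C (z (Suc s)) i"
    and perp: "\<And>s. wsum (z s) = 0"
    and bounded: "\<And>s. \<theta> ^ s * wnorm (z s) \<le> B"
    and i: "i < n"
  shows "z 0 i = 0"
proof -
  obtain \<rho> where \<rho>: "0 \<le> \<rho>" "\<rho> < 1"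
    and contract: "\<And>u. wsum u = 0 \<Longrightarrow> wnorm (mat_app (C ^\<^sub>m k) u) \<le> \<rho> * \<theta> ^ k * wnorm u"
    using contraction by blast
  have jump: "z s i = mat_app (C ^\<^sub>m m) (z (s + m)) i" if "i < n" for s m i
    using that
  proof (induction m)
    case 0
    then show ?case using A by (simp add: mat_app_one)
  next
    case (Suc m)
    have "mat_app (C ^\<^sub>m m) (z (s + m)) i = mat_app (C ^\<^sub>m m) (mat_app C (z (s + Suc m))) i"
      by (rule mat_app_cong[of _ n]) (use C_carrier orbit in auto)
    then show ?case
      using Suc C_carrier by (simp add: mat_app_times[of _ n])
  qed
  have shrink: "wnorm (z s) \<le> \<rho> * \<theta> ^ k * wnorm (z (s + k))" for s
  proof -
    have "wnorm (z s) = wnorm (mat_app (C ^\<^sub>m k) (z (s + k)))"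
      unfolding wnorm_def using jump by simp
    then show ?thesis
      using contract[OF perp] by simp
  qed
  have iter: "wnorm (z 0) \<le> \<rho> ^ j * (\<theta> ^ (j * k) * wnorm (z (j * k)))" for j
  proof (induction j)
    case (Suc j)
    have "\<rho> ^ j * \<theta> ^ (j * k) * wnorm (z (j * k)) \<le>
        \<rho> ^ j * \<theta> ^ (j * k) * (\<rho> * \<theta> ^ k * wnorm (z (j * k + k)))"
      using shrink[of "j * k"] \<rho> \<theta> by (intro mult_left_mono) auto
    also have "\<dots> = \<rho> ^ Suc j * (\<theta> ^ (Suc j * k) * wnorm (z (Suc j * k)))"
      by (simp add: power_add mult_ac add.commute)
    finally show ?case
      using Suc by (simp add: mult.assoc)
  qed simp
  have "wnorm (z 0) \<le> \<rho> ^ j * B" for j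
    using iter[of j] mult_left_mono[OF bounded[of "j * k"], of "\<rho> ^ j"] \<rho>(1) by simp
  moreover have "(\<lambda>j. \<rho> ^ j * B) \<longlonglongrightarrow> 0 * B"
    using \<rho> by (intro tendsto_mult_right LIMSEQ_realpow_zero)
  ultimately have "wnorm (z 0) \<le> 0"
    using LIMSEQ_le_const by fastforce
  then show ?thesis
    using wnorm_zero i by blast
qed

text \<open>For \<open>\<theta> \<le> \<bar>\<mu>\<bar>\<close> the vectors \<open>u / \<mu> ^ s\<close> form a backward orbit that stays within the bound of
  \<open>backward_orbit_zero\<close>.\<close>

lemma eigenvector_perp_zero:
  assumes ev: "\<And>i. i < n \<Longrightarrow> mat_app C u i = \<mu> * u i"
    and \<mu>: "\<theta> \<le> cmod \<mu>" and perp: "wsum u = 0" and i: "i < n"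
  shows "u i = 0"
proof -
  have \<mu>0: "\<mu> \<noteq> 0" "0 < cmod \<mu>"
    using \<mu> \<theta> by auto
  define z where "z s i = u i / \<mu> ^ s" for s i
  have "z 0 i = 0"
  proof (rule backward_orbit_zero[of z "wnorm u"])
    show "z s i = mat_app C (z (Suc s)) i" if "i < n" for s i
    proof -
      have "mat_app C (z (Suc s)) i = mat_app C u i / \<mu> ^ Suc s"
        by (simp add: z_def mat_app_def sum_divide_distrib)
      then show ?thesis
        using ev[OF that] \<mu>0 by (simp add: z_def)
    qed
    show "wsum (z s) = 0" for s
    proof -
      have "wsum (z s) = wsum u / \<mu> ^ s"
        by (simp add: wsum_def z_def sum_divide_distrib)
      then show ?thesis using perp by simp
    qed
    show "\<theta> ^ s * wnorm (z s) \<le> wnorm u" for s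
    proof -
      have "\<theta> ^ s * wnorm (z s) = (\<theta> / cmod \<mu>) ^ s * wnorm u"
        by (simp add: wnorm_def z_def norm_divide norm_power power_divide sum_distrib_left)
      also have "\<dots> \<le> 1 * wnorm u"
        using \<mu> \<theta> \<mu>0 wnorm_nonneg by (intro mult_right_mono power_le_one) auto
      finally show ?thesis by simp
    qed
  qed (rule i)
  then show ?thesis
    by (simp add: z_def)
qed

text \<open>Subtract the multiple of \<open>v\<close> that makes the difference orthogonal to \<open>w\<close>.\<close>

lemma perron_eigenspace:
  assumes ev: "\<And>i. i < n \<Longrightarrow> mat_app C u i = complex_of_real \<theta> * u i"
  obtains c where "\<And>i. i < n \<Longrightarrow> u i = c * complex_of_real (v i)"
proof -
  define c where "c = wsum u / wsum (\<lambda>i. of_real (v i))"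
  have "u i - c * complex_of_real (v i) = 0" if "i < n" for i
  proof (rule eigenvector_perp_zero[of "\<lambda>i. u i - c * complex_of_real (v i)" "of_real \<theta>"])
    show "mat_app C (\<lambda>i. u i - c * complex_of_real (v i)) i = of_real \<theta> * (u i - c * complex_of_real (v i))" if "i < n" for i
    proof -
      have "mat_app C (\<lambda>i. u i - c * complex_of_real (v i)) i = mat_app C u i - c * mat_app C (\<lambda>i. of_real (v i)) i"
        by (simp add: mat_app_def right_diff_distrib sum_subtractf sum_distrib_left mult.left_commute)
      then show ?thesis
        unfolding ev[OF that] app_v[OF that] by (simp add: algebra_simps)
    qed
    have "wsum (\<lambda>i. u i - c * complex_of_real (v i)) = wsum u - c * wsum (\<lambda>i. of_real (v i))"
      by (simp add: wsum_def right_diff_distrib sum_subtractf sum_distrib_left mult.left_commute)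
    then show "wsum (\<lambda>i. u i - c * complex_of_real (v i)) = 0"
      using wsum_v_nonzero by (simp add: c_def)
  qed (use \<theta> that in auto)
  then show ?thesis
    by (intro that[of c]) simp
qed

lemma eigenvalue_less:
  assumes "eigenvalue C \<mu>" "\<mu> \<noteq> complex_of_real \<theta>"
  shows "cmod \<mu> < \<theta>"
proof (rule ccontr)
  assume "\<not> cmod \<mu> < \<theta>"
  then have le: "\<theta> \<le> cmod \<mu>" by simp
  obtain u where u: "u \<in> carrier_vec n" "u \<noteq> 0\<^sub>v n" "C *\<^sub>v u = \<mu> \<cdot>\<^sub>v u"
    using assms(1) A unfolding eigenvalue_def eigenvector_def by auto
  have ev: "mat_app C (($) u) i = \<mu> * u $ i" if "i < n" for i
    using mat_app_mult_vec[OF C_carrier u(1) that] u that by simp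
  have "complex_of_real \<theta> * wsum (($) u) = wsum (\<lambda>i. \<mu> * u $ i)"
    unfolding wsum_app[symmetric] by (rule wsum_cong) (rule ev)
  also have "\<dots> = \<mu> * wsum (($) u)"
    by (simp add: wsum_def sum_distrib_left mult.left_commute)
  finally have "wsum (($) u) = 0"
    using assms(2) by simp
  then have "u $ i = 0" if "i < n" for i
    using eigenvector_perp_zero[OF ev le _ that] by simp
  then show False
    using u by (auto simp: vec_eq_iff)
qed

lemma eigenvalue_theta: "eigenvalue C (complex_of_real \<theta>)"
proof -
  have "C *\<^sub>v vec n (\<lambda>i. of_real (v i)) = of_real \<theta> \<cdot>\<^sub>v vec n (\<lambda>i. of_real (v i))"
  proof (rule eq_vecI)
    fix i assume "i < dim_vec (of_real \<theta> \<cdot>\<^sub>v vec n (\<lambda>i. complex_of_real (v i)))"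
    then have i: "i < n" by simp
    have "mat_app C (($) (vec n (\<lambda>i. complex_of_real (v i)))) i = mat_app C (\<lambda>i. of_real (v i)) i"
      by (rule mat_app_cong[OF C_carrier]) simp
    then show "(C *\<^sub>v vec n (\<lambda>i. of_real (v i))) $ i = (of_real \<theta> \<cdot>\<^sub>v vec n (\<lambda>i. of_real (v i))) $ i"
      using mat_app_mult_vec[OF C_carrier _ i] app_v[OF i] i by simp
  qed (use A in auto)
  moreover have "vec n (\<lambda>i. complex_of_real (v i)) \<noteq> 0\<^sub>v n"
    using v(1)[OF n] n by (auto simp: vec_eq_iff)
  ultimately show ?thesis
    using A unfolding eigenvalue_def eigenvector_def by (intro exI[of _ "vec n (\<lambda>i. of_real (v i))"]) auto
qed

text \<open>If \<open>\<theta>\<close> were a multiple root, an upper triangular form with \<open>\<theta>\<close> in its first two diagonal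
  places would give independent vectors \<open>p\<^sub>0\<close>, \<open>p\<^sub>1\<close> with \<open>A p\<^sub>0 = \<theta> p\<^sub>0\<close> and
  \<open>A p\<^sub>1 = b p\<^sub>0 + \<theta> p\<^sub>1\<close>. Pairing the second equation with \<open>w\<close> yields \<open>b = 0\<close>, so both
  lie in the eigenspace, which is spanned by \<open>v\<close>.\<close>

lemma order_theta: "Polynomial.order (complex_of_real \<theta>) (char_poly C) = 1"
proof (rule ccontr)
  let ?t = "complex_of_real \<theta>"
  assume ne: "Polynomial.order ?t (char_poly C) \<noteq> 1"
  have p0: "char_poly C \<noteq> 0"
    using degree_monic_char_poly[OF C_carrier] by auto
  have "poly (char_poly C) ?t = 0"
    using eigenvalue_theta eigenvalue_root_char_poly[OF C_carrier] by simp
  then have "Polynomial.order ?t (char_poly C) \<noteq> 0"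
    using p0 by (simp add: order_root)
  with ne have "2 \<le> Polynomial.order ?t (char_poly C)"
    by simp
  then have "[:- ?t, 1:] ^ 2 dvd char_poly C"
    using p0 by (simp add: order_divides)
  then obtain q where q: "char_poly C = [:- ?t, 1:] ^ 2 * q"
    by (elim dvdE)
  have q0: "q \<noteq> 0"
    using p0 q by auto
  have lead: "lead_coeff q = 1"
  proof -
    have "lead_coeff ([:- ?t, 1:] ^ 2) = 1"
      unfolding lead_coeff_power by simp
    moreover have "lead_coeff (char_poly C) = 1"
      using degree_monic_char_poly[OF C_carrier] by simp
    ultimately show ?thesis
      unfolding q lead_coeff_mult by simp
  qed
  obtain es where es: "q = (\<Prod>e\<leftarrow>es. [:- e, 1:])"
    using fundamental_theorem_algebra_factorized[of q] unfolding lead by force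
  have cp: "char_poly C = (\<Prod>e\<leftarrow>?t # ?t # es. [:- e, 1:])"
    unfolding q es by (simp add: power2_eq_square mult.assoc del: mult_pCons_left mult_pCons_right)
  obtain T P Q where schur: "schur_decomposition C (?t # ?t # es) = (T, P, Q)"
    by (metis prod_cases3)
  have T: "similar_mat_wit C T P Q" "upper_triangular T" "diag_mat T = ?t # ?t # es"
    using schur_decomposition[OF C_carrier cp schur] by auto
  note sim = similar_mat_witD2[OF C_carrier T(1)]
  have n2: "2 \<le> n"
    using arg_cong[OF T(3), of length] sim(5) by (simp add: diag_mat_def)
  have diag: "T $$ (i, i) = (?t # ?t # es) ! i" if "i < n" for i
    using arg_cong[OF T(3), of "\<lambda>xs. xs ! i"] sim(5) that by (simp add: diag_mat_def)
  have T00: "T $$ (0, 0) = ?t" and T11: "T $$ (1, 1) = ?t"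
    using diag[of 0] diag[of 1] n2 by auto
  have CP: "C * P = P * T"
  proof -
    have "C * P = P * T * (Q * P)"
      unfolding sim(3) using sim by (simp add: assoc_mult_mat[of _ n n _ n _ n])
    then show ?thesis
      using sim by simp
  qed
  have col: "mat_app C (\<lambda>i. P $$ (i, j)) i = (\<Sum>l\<le>j. P $$ (i, l) * T $$ (l, j))"
    if i: "i < n" and j: "j < n" for i j
  proof -
    have "mat_app C (\<lambda>i. P $$ (i, j)) i = (C * P) $$ (i, j)"
      using sim(6) A i j by (simp add: mat_app_def scalar_prod_def lessThan_atLeast0)
    also have "\<dots> = (\<Sum>l<n. P $$ (i, l) * T $$ (l, j))"
      unfolding CP using sim(5,6) i j by (simp add: scalar_prod_def lessThan_atLeast0)
    also have "\<dots> = (\<Sum>l\<le>j. P $$ (i, l) * T $$ (l, j))"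
      using T(2) sim(5) j
      by (intro sum.mono_neutral_right) (auto simp: upper_triangular_def)
    finally show ?thesis .
  qed
  have col0: "mat_app C (\<lambda>i. P $$ (i, 0)) i = ?t * P $$ (i, 0)" if "i < n" for i
    using col[OF that, of 0] n T00 by simp
  obtain a where a: "\<And>i. i < n \<Longrightarrow> P $$ (i, 0) = a * complex_of_real (v i)"
    using perron_eigenspace[OF col0] by blast
  have QP: "(\<Sum>l<n. Q $$ (i, l) * P $$ (l, j)) = (if i = j then 1 else 0)" if "i < n" "j < n" for i j
    using arg_cong[OF sim(2), of "\<lambda>X. X $$ (i, j)"] that sim(6,7)
    by (simp add: scalar_prod_def lessThan_atLeast0)
  have "a \<noteq> 0"
    using QP[of 0 0] n a by auto
  let ?p1 = "\<lambda>i. P $$ (i, 1)"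
  let ?b = "T $$ (0, 1)"
  have col1: "mat_app C ?p1 i = ?b * (a * complex_of_real (v i)) + ?t * ?p1 i" if "i < n" for i
    using col[OF that, of 1] n2 T11 a[OF that] by (simp add: mult.commute)
  have "?t * wsum ?p1 = wsum (\<lambda>i. ?b * (a * complex_of_real (v i)) + ?t * ?p1 i)"
    unfolding wsum_app[symmetric] by (rule wsum_cong) (rule col1)
  also have "\<dots> = ?b * a * wsum (\<lambda>i. of_real (v i)) + ?t * wsum ?p1"
    by (simp add: wsum_def distrib_left sum.distrib sum_distrib_left mult_ac)
  finally have "?b = 0"
    using \<open>a \<noteq> 0\<close> wsum_v_nonzero by simp
  then have "mat_app C ?p1 i = ?t * ?p1 i" if "i < n" for i
    using col1[OF that] by simp
  then obtain c where c: "\<And>i. i < n \<Longrightarrow> ?p1 i = c * complex_of_real (v i)"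
    using perron_eigenspace by blast
  have "(\<Sum>l<n. Q $$ (0, l) * complex_of_real (v l)) * a = 1"
    using QP[of 0 0] n a by (simp add: sum_distrib_left mult_ac)
  moreover have "(\<Sum>l<n. Q $$ (0, l) * complex_of_real (v l)) * c = 0"
    using QP[of 0 1] n2 c by (simp add: sum_distrib_left mult_ac)
  ultimately have "c = 0"
    by auto
  then show False
    using QP[of 1 1] n2 c by simp
qed

text \<open>A nonnegative backward orbit \<open>x\<close> decays like \<open>\<theta> ^ (- s)\<close>, because its pairing with \<open>w\<close>
  does. After subtraction of the orbit \<open>c v / \<theta> ^ s\<close> with the same pairing nothing remains.\<close>

lemma trace_unique:
  fixes x :: "nat \<Rightarrow> nat \<Rightarrow> real"
  assumes orbit: "\<And>s i. i < n \<Longrightarrow> x s i = mat_app A (x (Suc s)) i"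
    and nonneg: "\<And>s i. i < n \<Longrightarrow> 0 \<le> x s i"
  obtains c where "\<And>i. i < n \<Longrightarrow> x 0 i = c * v i"
proof -
  define X where "X s = (\<Sum>i<n. w i * x s i)" for s
  define V where "V = (\<Sum>i<n. w i * v i)"
  have V: "0 < V"
    unfolding V_def using n v(1) w(1) by (intro sum_pos) auto
  have X_Suc: "X s = \<theta> * X (Suc s)" for s
  proof -
    have "X s = (\<Sum>i<n. w i * mat_app A (x (Suc s)) i)"
      unfolding X_def by (intro sum.cong refl arg_cong2[where f = "(*)"] orbit) simp
    also have "\<dots> = (\<Sum>i<n. \<Sum>j<n. w i * (A $$ (i, j) * x (Suc s) j))"
      using A by (simp add: mat_app_def sum_distrib_left)
    also have "\<dots> = (\<Sum>j<n. (\<Sum>i<n. w i * A $$ (i, j)) * x (Suc s) j)"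
      by (subst sum.swap) (simp add: sum_distrib_right mult.assoc)
    also have "\<dots> = \<theta> * X (Suc s)"
      using w(2) by (simp add: X_def sum_distrib_left mult.assoc)
    finally show ?thesis .
  qed
  have X: "\<theta> ^ s * X s = X 0" for s
  proof (induction s)
    case (Suc s)
    then show ?case
      using X_Suc[of s] by (simp add: mult_ac)
  qed simp
  have X0: "0 \<le> X 0"
    unfolding X_def using nonneg w(1) by (intro sum_nonneg mult_nonneg_nonneg) (auto intro: less_imp_le)
  define c where "c = X 0 / V"
  have c0: "0 \<le> c"
    using X0 V by (simp add: c_def)
  define y where "y s i = x s i - c / \<theta> ^ s * v i" for s i
  have "complex_of_real (y 0 i) = 0" if i: "i < n" for i
  proof (rule backward_orbit_zero[of "\<lambda>s i. of_real (y s i)" "2 * X 0"])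
    show "complex_of_real (y s i) = mat_app C (\<lambda>i. of_real (y (Suc s) i)) i" if i: "i < n" for s i
    proof -
      have "mat_app A (y (Suc s)) i = mat_app A (x (Suc s)) i - c / \<theta> ^ Suc s * mat_app A v i"
        by (simp add: y_def mat_app_def right_diff_distrib sum_subtractf sum_distrib_left mult_ac)
      also have "\<dots> = y s i"
        using orbit[OF i, of s] v(2)[OF i] \<theta> by (simp add: y_def)
      finally have "y s i = mat_app A (y (Suc s)) i" ..
      then show ?thesis
        using A i by (simp add: mat_app_def)
    qed
    show "wsum (\<lambda>i. complex_of_real (y s i)) = 0" for s
    proof -
      have "(\<Sum>i<n. w i * y s i) = X s - c / \<theta> ^ s * V"
        by (simp add: y_def X_def V_def right_diff_distrib sum_subtractf sum_distrib_left mult_ac)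
      also have "\<dots> = 0"
        using X[of s] \<theta> V by (simp add: c_def field_simps)
      finally have "complex_of_real (\<Sum>i<n. w i * y s i) = 0"
        by simp
      then show ?thesis
        by (simp add: wsum_def)
    qed
    show "\<theta> ^ s * wnorm (\<lambda>i. complex_of_real (y s i)) \<le> 2 * X 0" for s
    proof -
      have ts: "0 < \<theta> ^ s"
        using \<theta> by simp
      have "wnorm (\<lambda>i. complex_of_real (y s i)) \<le> (\<Sum>i<n. w i * (x s i + c / \<theta> ^ s * v i))"
        unfolding wnorm_def
      proof (intro sum_mono mult_left_mono)
        fix i assume "i \<in> {..<n}"
        then have i: "i < n" by simp
        have "0 \<le> c / \<theta> ^ s * v i"
          using c0 ts v(1)[OF i] by simp
        then show "cmod (complex_of_real (y s i)) \<le> x s i + c / \<theta> ^ s * v i"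
          unfolding norm_of_real y_def using nonneg[OF i, of s] by (intro abs_diff_le_add)
        show "0 \<le> w i"
          using w(1)[OF i] by simp
      qed
      also have "\<dots> = X s + c / \<theta> ^ s * V"
        by (simp add: X_def V_def distrib_left sum.distrib sum_distrib_left mult_ac)
      finally have "\<theta> ^ s * wnorm (\<lambda>i. complex_of_real (y s i)) \<le> \<theta> ^ s * (X s + c / \<theta> ^ s * V)"
        using ts by (intro mult_left_mono) auto
      also have "\<dots> = \<theta> ^ s * X s + c * V"
        using \<theta> by (simp add: distrib_left)
      also have "\<dots> = 2 * X 0"
        using X[of s] V by (simp add: c_def)
      finally show ?thesis .
    qed
  qed (rule i)
  then have "y 0 i = 0" if "i < n" for i
    using that unfolding of_real_eq_0_iff .
  then have "x 0 i = c * v i" if "i < n" for i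
    using that by (simp add: y_def)
  then show ?thesis
    using that by blast
qed

end

section \<open>Stationary diagrams\<close>

lemma bverts_matrix_bratteli: "bverts (matrix_bratteli M) n = Pair n ` {..<dim_row M}"
  by (auto simp: matrix_bratteli_def)

lemma sum_bverts_matrix_bratteli:
  "(\<Sum>u \<in> bverts (matrix_bratteli M) n. h u) = (\<Sum>i < dim_row M. h (n, i))"
  unfolding bverts_matrix_bratteli by (subst sum.reindex) (auto simp: inj_on_def)

lemma edge_count_matrix_bratteli:
  assumes "i < dim_row M" "j < dim_row M"
  shows "edge_count (matrix_bratteli M) n (n, i) (Suc n, j) = M $$ (i, j)"
proof -
  have "{e \<in> bedges (matrix_bratteli M) (Suc n). bsrc (matrix_bratteli M) e = (n, i) \<and>
      brng (matrix_bratteli M) e = (Suc n, j)} = (\<lambda>k. (Suc n, i, j, k)) ` {..<M $$ (i, j)}"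
    using assms by (auto simp: matrix_bratteli_def)
  then show ?thesis
    by (simp add: edge_count_def card_image inj_on_def)
qed

lemma path_count_matrix_bratteli:
  assumes M: "M \<in> carrier_mat n n" and "i < n" "j < n"
  shows "path_count (matrix_bratteli M) a k (a, i) (a + k, j) = (M ^\<^sub>m k) $$ (i, j)"
  using assms(2)
proof (induction k arbitrary: a i)
  case 0
  then show ?case
    using M \<open>j < n\<close> by simp
next
  case (Suc k)
  have "path_count (matrix_bratteli M) a (Suc k) (a, i) (a + Suc k, j) =
      (\<Sum>l<n. M $$ (i, l) * path_count (matrix_bratteli M) (Suc a) k (Suc a, l) (Suc a + k, j))"
    using M Suc.prems by (simp add: sum_bverts_matrix_bratteli edge_count_matrix_bratteli)
  also have "\<dots> = (\<Sum>l<n. M $$ (i, l) * (M ^\<^sub>m k) $$ (l, j))"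
    using Suc.IH[of _ "Suc a"] by simp
  also have "\<dots> = (M ^\<^sub>m Suc k) $$ (i, j)"
    unfolding pow_mat_Suc_left[OF M] using M Suc.prems \<open>j < n\<close>
    by (simp add: scalar_prod_def lessThan_atLeast0)
  finally show ?case .
qed

text \<open>Simplicity yields an exponent \<open>k\<close> which may be 0, whereas primitivity asks for a positive one;
  the exponent \<open>Suc k\<close> works as well.\<close>

lemma primitive_iff_simple:
  assumes M: "M \<in> carrier_mat n n" and D: "bratteli_diagram (matrix_bratteli M)"
  shows "primitive_mat M \<longleftrightarrow> simple_diagram (matrix_bratteli M)"
proof
  assume "primitive_mat M"
  then obtain k where "\<forall>i<n. \<forall>j<n. (M ^\<^sub>m k) $$ (i, j) > 0"
    using M unfolding primitive_mat_def by auto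
  then show "simple_diagram (matrix_bratteli M)"
    unfolding simple_diagram_def bverts_matrix_bratteli
    using M path_count_matrix_bratteli[OF M] by (intro allI exI[of _ k]) auto
next
  assume "simple_diagram (matrix_bratteli M)"
  then obtain k where k: "\<forall>v \<in> bverts (matrix_bratteli M) 0. \<forall>w \<in> bverts (matrix_bratteli M) (0 + k).
      0 < path_count (matrix_bratteli M) 0 k v w"
    unfolding simple_diagram_def by blast
  have "(M ^\<^sub>m Suc k) $$ (i, j) > 0" if "i < n" "j < n" for i j
    using connects_later[OF D k, of "(0, i)" "(Suc k, j)" "Suc k"] that M
      path_count_matrix_bratteli[OF M that, of 0 "Suc k"]
    by (simp add: bverts_matrix_bratteli del: path_count.simps pow_mat.simps)
  then show "primitive_mat M"
    using M unfolding primitive_mat_def by (intro conjI exI[of _ "Suc k"]) auto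
qed

lemma transpose_pow_mat:
  fixes A :: "'a :: comm_semiring_1 mat"
  assumes A: "A \<in> carrier_mat n n"
  shows "transpose_mat (A ^\<^sub>m m) = transpose_mat A ^\<^sub>m m"
proof (induction m)
  case (Suc m)
  have "transpose_mat (A ^\<^sub>m Suc m) = transpose_mat A * transpose_mat (A ^\<^sub>m m)"
    using A by (simp add: transpose_mult[of _ n n _ n])
  then show ?case
    using Suc pow_mat_Suc_left[of "transpose_mat A" n m] A by simp
qed (use A in simp)

text \<open>The left eigenvector comes from the transpose. Evaluating \<open>w A v\<close> in two ways shows that its
  eigenvalue is the same.\<close>

lemma primitive_perron_data:
  assumes M: "M \<in> carrier_mat n n" and n: "0 < n" and prim: "primitive_mat M"
  obtains k \<theta> v w where "perron_data n k (map_mat real M) \<theta> v w"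
proof -
  let ?A = "map_mat real M"
  let ?B = "transpose_mat ?A"
  have A: "?A \<in> carrier_mat n n" and B: "?B \<in> carrier_mat n n"
    using M by auto
  obtain k where k: "1 \<le> k" "\<And>i j. i < n \<Longrightarrow> j < n \<Longrightarrow> 0 < (M ^\<^sub>m k) $$ (i, j)"
    using prim M unfolding primitive_mat_def by auto
  interpret real_hom: semiring_hom real
    by unfold_locales simp_all
  have "?A ^\<^sub>m k = map_mat real (M ^\<^sub>m k)"
    by (rule real_hom.mat_hom_pow[OF M, symmetric])
  then have pos: "0 < (?A ^\<^sub>m k) $$ (i, j)" if "i < n" "j < n" for i j
    using k(2)[OF that] M that by simp
  have posB: "0 < (?B ^\<^sub>m k) $$ (i, j)" if "i < n" "j < n" for i j
    using pos[OF that(2,1)] that A by (simp add: transpose_pow_mat[OF A, symmetric])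
  obtain \<theta> v where v: "0 < \<theta>" "\<And>i. i < n \<Longrightarrow> 0 < v i" "\<And>i. i < n \<Longrightarrow> mat_app ?A v i = \<theta> * v i"
    using perron_vector[OF A n k(1) _ pos] M by auto
  obtain \<eta> w where w: "0 < \<eta>" "\<And>i. i < n \<Longrightarrow> 0 < w i" "\<And>i. i < n \<Longrightarrow> mat_app ?B w i = \<eta> * w i"
    using perron_vector[OF B n k(1) _ posB] M by auto
  have w': "(\<Sum>i<n. w i * ?A $$ (i, j)) = \<eta> * w j" if "j < n" for j
    using w(3)[OF that] M that by (simp add: mat_app_def mult.commute)
  have "\<eta> * (\<Sum>j<n. w j * v j) = (\<Sum>j<n. (\<Sum>i<n. w i * ?A $$ (i, j)) * v j)"
    using w' by (simp add: sum_distrib_left mult.assoc)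
  also have "\<dots> = (\<Sum>i<n. w i * mat_app ?A v i)"
    unfolding mat_app_def sum_distrib_left sum_distrib_right
    using A by (subst sum.swap) (simp add: mult.assoc)
  also have "\<dots> = \<theta> * (\<Sum>j<n. w j * v j)"
    using v(3) by (simp add: sum_distrib_left mult_ac)
  finally have "\<eta> * (\<Sum>j<n. w j * v j) = \<theta> * (\<Sum>j<n. w j * v j)" .
  moreover have "0 < (\<Sum>j<n. w j * v j)"
    using n v(2) w(2) by (intro sum_pos) auto
  ultimately have "\<eta> = \<theta>"
    by simp
  then have "perron_data n k ?A \<theta> v w"
    using A n pos v w w' by unfold_locales auto
  then show ?thesis ..
qed

lemma complex_mat_of_nat:
  "(map_mat of_nat M :: complex mat) = map_mat complex_of_real (map_mat real M)"
  by (rule eq_matI) auto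

lemma perron_data_PF:
  assumes "perron_data n k (map_mat real M) \<theta> v w"
  shows "is_PF_eigenvalue M \<theta>"
proof -
  interpret perron_data n k "map_mat real M" \<theta> v w
    by (rule assms)
  show ?thesis
    unfolding is_PF_eigenvalue_def Let_def complex_mat_of_nat
    using eigenvalue_theta order_theta eigenvalue_less \<theta> by simp
qed

text \<open>The values of a rational trace on level 0 form a multiple of \<open>v\<close>, and \<open>\<theta>\<close> is the ratio of two
  rational numbers. Conversely, \<open>\<theta>\<close> being rational is an eigenvalue of \<open>M\<close> over the rationals; a
  rational eigenvector \<open>u\<close> is a multiple of \<open>v\<close>, and dividing it by its entry at 0 makes it
  positive.\<close>

lemma trace_iff_rational:
  assumes M: "M \<in> carrier_mat n n" and perron: "perron_data n k (map_mat real M) \<theta> v w"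
  shows "(\<exists>x. positive_rational_trace (matrix_bratteli M) x) \<longleftrightarrow> \<theta> \<in> \<rat>"
proof -
  interpret perron_data n k "map_mat real M" \<theta> v w
    by (rule perron)
  have dims: "dim_row M = n" "dim_col M = n"
    using M by auto
  show ?thesis
  proof
    assume "\<exists>x. positive_rational_trace (matrix_bratteli M) x"
    then obtain x where x: "positive_rational_trace (matrix_bratteli M) x" ..
    define X where "X s i = real_of_rat (x (s, i))" for s i
    have in_level: "(s, i) \<in> bverts (matrix_bratteli M) s" if "i < n" for s i
      using that dims by (simp add: bverts_matrix_bratteli)
    have pos: "0 < X s i" if "i < n" for s i
      using trace_pos[OF x in_level[OF that]] by (simp add: X_def)
    have orbit: "X s i = mat_app (map_mat real M) (X (Suc s)) i" if "i < n" for s i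
    proof -
      have "x (s, i) = (\<Sum>j<n. of_nat (M $$ (i, j)) * x (Suc s, j))"
        unfolding trace_eq[OF x in_level[OF that]] sum_bverts_matrix_bratteli
        using that dims by (simp add: edge_count_matrix_bratteli)
      then have "X s i = real_of_rat (\<Sum>j<n. of_nat (M $$ (i, j)) * x (Suc s, j))"
        by (simp only: X_def)
      then show ?thesis
        using that dims by (simp add: X_def mat_app_def of_rat_sum of_rat_mult)
    qed
    obtain c where c: "\<And>i. i < n \<Longrightarrow> X 0 i = c * v i"
      using trace_unique[of X] orbit pos less_imp_le by metis
    have "\<theta> * X 0 0 = c * mat_app (map_mat real M) v 0"
      using c[OF n] v(2)[OF n] by simp
    also have "\<dots> = mat_app (map_mat real M) (\<lambda>i. c * v i) 0"
      by (simp add: mat_app_def sum_distrib_left mult.left_commute)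
    also have "\<dots> = mat_app (map_mat real M) (X 0) 0"
      by (rule mat_app_cong[OF A]) (simp add: c)
    also have "\<dots> = real_of_rat (\<Sum>j<n. of_nat (M $$ (0, j)) * x (0, j))"
      using n dims by (simp add: X_def mat_app_def of_rat_sum of_rat_mult)
    finally have "\<theta> = real_of_rat (\<Sum>j<n. of_nat (M $$ (0, j)) * x (0, j)) / X 0 0"
      using pos[OF n, of 0] by (simp add: field_simps)
    then show "\<theta> \<in> \<rat>"
      by (simp add: X_def)
  next
    assume "\<theta> \<in> \<rat>"
    then obtain q where q: "\<theta> = real_of_rat q"
      unfolding Rats_def by blast
    let ?R = "map_mat of_nat M :: rat mat"
    have R: "?R \<in> carrier_mat n n"
      using M by simp
    have CR: "C = map_mat of_rat ?R"
      using M by (intro eq_matI) auto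
    have of_rat_complex: "complex_of_real (real_of_rat a) = of_rat a" for a
      by (cases a) (simp add: of_rat_rat)
    have \<theta>q: "complex_of_real \<theta> = of_rat q"
      unfolding q by (rule of_rat_complex)
    have "poly (map_poly of_rat (char_poly ?R)) (of_rat q :: complex) = 0"
      using eigenvalue_theta eigenvalue_root_char_poly[OF C_carrier]
      unfolding \<theta>q CR of_rat_hom.char_poly_hom[OF R] by simp
    then have "eigenvalue ?R q"
      using eigenvalue_root_char_poly[OF R] by simp
    then obtain u where u: "eigenvector ?R u q"
      unfolding eigenvalue_def ..
    then have u': "u \<in> carrier_vec n" "u \<noteq> 0\<^sub>v n" "?R *\<^sub>v u = q \<cdot>\<^sub>v u"
      using R unfolding eigenvector_def by auto
    have Ru: "(\<Sum>j<n. of_nat (M $$ (i, j)) * u $ j) = q * u $ i" if "i < n" for i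
      using arg_cong[OF u'(3), of "\<lambda>x. x $ i"] mat_app_mult_vec[OF R u'(1) that] u'(1) that dims
      by (simp add: mat_app_def)
    have "mat_app C (\<lambda>i. of_rat (u $ i)) i = complex_of_real \<theta> * of_rat (u $ i)" if "i < n" for i
    proof -
      have "mat_app C (\<lambda>i. of_rat (u $ i)) i = of_rat (\<Sum>j<n. of_nat (M $$ (i, j)) * u $ j)"
        using that dims by (simp add: mat_app_def of_rat_sum of_rat_mult)
      then show ?thesis
        unfolding Ru[OF that] \<theta>q by (simp add: of_rat_mult)
    qed
    then obtain c where c: "\<And>i. i < n \<Longrightarrow> (of_rat (u $ i) :: complex) = c * complex_of_real (v i)"
      using perron_eigenspace[of "\<lambda>i. of_rat (u $ i)"] by blast
    have u0: "u $ 0 \<noteq> 0"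
    proof
      assume "u $ 0 = 0"
      then have "c = 0"
        using c[OF n] v(1)[OF n] by simp
      then have "u $ i = 0" if "i < n" for i
        using c[OF that] by simp
      then show False
        using u'(1,2) by (auto simp: vec_eq_iff)
    qed
    define y where "y i = u $ i / u $ 0" for i
    have y: "0 < y i" if i: "i < n" for i
    proof -
      have "c \<noteq> 0"
        using c[OF n] u0 by auto
      then have "complex_of_real (real_of_rat (y i)) = complex_of_real (v i / v 0)"
        using c[OF i] c[OF n] unfolding of_rat_complex by (simp add: y_def of_rat_divide)
      then have "real_of_rat (y i) = v i / v 0"
        unfolding of_real_eq_iff .
      then have "0 < real_of_rat (y i)"
        using v(1) i n by simp
      then show ?thesis by simp
    qed
    have q0: "0 < q"
      using \<theta> q by simp
    define x where "x = (\<lambda>(s :: nat, i). y i / q ^ s)"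
    have orbit: "x (s, i) = (\<Sum>j<n. of_nat (M $$ (i, j)) * x (Suc s, j))" if "i < n" for s i
    proof -
      have "(\<Sum>j<n. of_nat (M $$ (i, j)) * x (Suc s, j)) =
          (\<Sum>j<n. of_nat (M $$ (i, j)) * u $ j) / (u $ 0 * q ^ Suc s)"
        by (simp add: x_def y_def sum_divide_distrib)
      then show ?thesis
        unfolding Ru[OF that] using q0 by (simp add: x_def y_def)
    qed
    have pos: "0 < x (s, i)" if "i < n" for s i
      using y[OF that] q0 by (simp add: x_def)
    have "positive_rational_trace (matrix_bratteli M) x"
      unfolding positive_rational_trace_def sum_bverts_matrix_bratteli
    proof (intro allI ballI conjI)
      fix s p assume "p \<in> bverts (matrix_bratteli M) s"
      then obtain i where p: "p = (s, i)" and i: "i < n"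
        using dims by (auto simp: bverts_matrix_bratteli)
      show "0 < x p"
        unfolding p by (rule pos[OF i])
      have "(\<Sum>j<dim_row M. of_nat (edge_count (matrix_bratteli M) s (s, i) (Suc s, j)) * x (Suc s, j)) =
          (\<Sum>j<n. of_nat (M $$ (i, j)) * x (Suc s, j))"
        using i dims by (simp add: edge_count_matrix_bratteli)
      then show "x p = (\<Sum>j<dim_row M. of_nat (edge_count (matrix_bratteli M) s p (Suc s, j)) * x (Suc s, j))"
        unfolding p orbit[OF i] by (rule sym)
    qed
    then show "\<exists>x. positive_rational_trace (matrix_bratteli M) x"
      by blast
  qed
qed

theorem purely_aperiodic_iff:
  assumes M: "M \<in> carrier_mat n n" and n: "0 < n" and D: "bratteli_diagram (matrix_bratteli M)"
  shows "purely_aperiodic M \<longleftrightarrow> simple_diagram (matrix_bratteli M) \<and>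
    \<not> (\<exists>x. positive_rational_trace (matrix_bratteli M) x)"
proof (cases "primitive_mat M")
  case True
  then obtain k \<theta> v w where P: "perron_data n k (map_mat real M) \<theta> v w"
    using primitive_perron_data[OF M n] by blast
  have "purely_aperiodic M \<longleftrightarrow> \<theta> \<notin> \<rat>"
    unfolding purely_aperiodic_def
    using True perron_data_PF[OF P] is_PF_eigenvalue_unique by blast
  then show ?thesis
    using trace_iff_rational[OF M P] primitive_iff_simple[OF M D] True by blast
next
  case False
  then show ?thesis
    using primitive_iff_simple[OF M D] by (simp add: purely_aperiodic_def)
qed

section \<open>Pure aperiodicity is invariant under telescope equivalence\<close>

theorem proposition5p7:
  fixes L :: "'a list" and \<sigma> :: "'a \<Rightarrow> 'a list"
    and K :: "'b list" and \<tau> :: "'b \<Rightarrow> 'b list"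
    and M N :: "nat mat"
  assumes "symbolic_substitution L \<sigma>" and "M = substitution_matrix L \<sigma>"
    and "symbolic_substitution K \<tau>" and "N = substitution_matrix K \<tau>"
    and "no_zero_row_or_col M" and "no_zero_row_or_col N"
    and "telescope_equivalent (matrix_bratteli M) (matrix_bratteli N)"
  shows "purely_aperiodic M \<longleftrightarrow> purely_aperiodic N"
proof -
  have M: "M \<in> carrier_mat (length L) (length L)" "0 < length L"
    and N: "N \<in> carrier_mat (length K) (length K)" "0 < length K"
    using assms(1-4) by (simp_all add: symbolic_substitution_def substitution_matrix_def)
  have D: "bratteli_diagram (matrix_bratteli M)" "bratteli_diagram (matrix_bratteli N)"
    using bratteli_diagram_matrix_bratteli M N assms(5,6) by auto
  show ?thesis
    unfolding purely_aperiodic_iff[OF M D(1)] purely_aperiodic_iff[OF N D(2)]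
    using telescope_equivalent_invariants[OF assms(7) D] by blast
qed

end
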